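(* Let $a,b,c\ge 0$ be integers (the numbers of variables of each type), let $k$ be an integer, and consider the Diophantine equation $$\sum_{i=1}^{a} p_i^2-\sum_{i=1}^{b} p_{a+i}^2+2\sum_{i=1}^{c} p_{a+b+2i-1}\,p_{a+b+2i}=k \qquad (\ast)$$ in integer unknowns $p_1,\dots,p_{a+b+2c}$. Then: 1. If ($a\ge 1$ or $b\ge 1$) and $c\ge 1$, then $(\ast)$ has a solution for every $k\in\mathbb{Z}$. 2. If $a\ge 4$ and $b=c=0$, then $(\ast)$ has a solution for every $k\ge 0$ and no solution for $k<0$. 3. If $b\ge 4$ and $a=c=0$, then $(\ast)$ has a solution for every $k\le 0$ and no solution for $k>0$. 4. If $a=3$ and $b=c=0$, then $(\ast)$ has a solution for every $k\ge 0$ that is not of the form $4^p(8q+7)$ with integers $p,q\ge 0$, and no solution if $k$ is of this form or if $k<0$. 5. If $b=3$ and $a=c=0$, then $(\ast)$ has a solution for every $k\le 0$ that is not of the form $-4^p(8q+7)$ with integers $p,q\ge 0$, and no solution if $k$ is of this form or if $k>0$. 6. If $a=2$ and $b=c=0$, then $(\ast)$ has a solution if $k=0$ or if $k>0$ and every prime number of the form $4p-1$ that divides $k$ occurs with even exponent in the prime factorization of $k$; in all other cases it has no solution. 7. If $b=2$ and $a=c=0$, then $(\ast)$ has a solution if $k=0$ or if $k<0$ and every prime number of the form $4p-1$ that divides $|k|$ occurs with even exponent in the prime factorization of $|k|$; in all other cases it has no solution. 8. If $a=b=1$ and $c=0$, then $(\ast)$ has a solution for every integer $k$ not of the form $4p+2$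 ($p\in\mathbb{Z}$), and no solution if $k=4p+2$. 9. If $a=1$ and $b=c=0$, then $(\ast)$ has a solution if $k$ is the square of an integer, and no solution otherwise. 10. If $b=1$ and $a=c=0$, then $(\ast)$ has a solution if $-k$ is the square of an integer, and no solution otherwise. 11. If $a=b=0$ and $c\ge 1$, then $(\ast)$ has a solution for every even integer $k$.
   Context: Solutions are tuples of integers $(p_1,\dots,p_{a+b+2c})\in\mathbb{Z}^{a+b+2c}$; empty sums are $0$. *)

theory Defs
  imports "HOL-Computational_Algebra.Primes" "HOL-Library.FuncSet"
begin

definition dioph_form :: "nat \<Rightarrow> nat \<Rightarrow> nat \<Rightarrow> (nat \<Rightarrow> int) \<Rightarrow> int" where
  "dioph_form a b c p =
     (\<Sum>i=1..a. (p i)\<^sup>2) - (\<Sum>i=1..b. (p (a + i))\<^sup>2)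
       + 2 * (\<Sum>i=1..c. p (a + b + 2 * i - 1) * p (a + b + 2 * i))"

(* A tuple (p_1, ..., p_n) of integers is an extensional function on {1..n}. *)
definition dioph_solutions :: "nat \<Rightarrow> nat \<Rightarrow> nat \<Rightarrow> int \<Rightarrow> (nat \<Rightarrow> int) set" where
  "dioph_solutions a b c k =
     {p \<in> {1..a + b + 2 * c} \<rightarrow>\<^sub>E (UNIV :: int set). dioph_form a b c p = k}"

definition has_solution :: "nat \<Rightarrow> nat \<Rightarrow> nat \<Rightarrow> int \<Rightarrow> bool" where
  "has_solution a b c k \<longleftrightarrow> dioph_solutions a b c k \<noteq> {}"

end

theory Submission
  imports Defs "HOL-Number_Theory.Number_Theory" "HOL-Computational_Algebra.Squarefree"
begin

text \<open>
  Everything except sums of two and three squares is elementary. For squarefree \<open>N \<noteq> 7 (mod 8)\<close>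
  one looks for \<open>A > 0\<close>, squarefree and prime to \<open>N\<close>, such that \<open>-N\<close> is a square modulo \<open>A\<close> and
  \<open>-A\<close> is a square modulo \<open>N\<close>. From such an \<open>A\<close> one writes down an integral positive definite
  ternary form of determinant 1 that has \<open>N\<close> as a principal minor. By Hermite reduction the form is
  the Gram matrix of three integer vectors, so \<open>N\<close> is the squared length of a cross product.

  The number \<open>A\<close> (or \<open>A / 2\<close>) is usually taken prime, by Dirichlet's theorem. It need not be:
  if \<open>\<chi> = (-N/\<cdot>)\<close> and \<open>r(n) = (\<Sum>d dvd n. \<chi>(d))\<close>, then \<open>r(n) \<noteq> 0\<close> forces every prime with odd
  exponent in \<open>n\<close> to satisfy \<open>\<chi>(q) = 1\<close>, and the squarefree part of \<open>n\<close> serves as \<open>A\<close> once the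
  symbols \<open>(n/p)\<close> for \<open>p\<close> dividing \<open>N\<close> have the right signs \<open>\<epsilon>(p)\<close>. Such an \<open>n\<close> exists because in
  the expansion of \<open>\<Sum>n. r(n) / sqrt n * (\<Prod>p. 1 + \<epsilon>(p) (n/p))\<close> the principal term diverges (already
  the squares \<open>n\<close> contribute a harmonic series), while every other term is bounded, by
  Dirichlet's hyperbola method, or nonnegative.
\<close>

section \<open>Hermite reduction of definite forms of determinant 1\<close>

lemma balanced_residue:
  fixes a t :: int
  assumes "a > 0"
  obtains k where "2 * \<bar>t + k * a\<bar> \<le> a"
proof -
  define m where "m = t mod a"
  have m: "0 \<le> m" "m < a" "t = a * (t div a) + m" using assms by (auto simp: m_def)
  show ?thesis
  proof (cases "2 * m \<le> a")
    case True
    have "t + (- (t div a)) * a = m" using m(3) by (simp add: algebra_simps)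
    then show ?thesis using that[of "- (t div a)"] True m by auto
  next
    case False
    have "t + (- (t div a) - 1) * a = m - a" using m(3) by (simp add: algebra_simps)
    then show ?thesis using that[of "- (t div a) - 1"] False m by auto
  qed
qed

lemma four_square_le:
  fixes a t :: int
  assumes "2 * \<bar>t\<bar> \<le> a"
  shows "4 * t\<^sup>2 \<le> a\<^sup>2"
proof -
  have "(2 * \<bar>t\<bar>)\<^sup>2 \<le> a\<^sup>2" using assms by (intro power_mono) auto
  then show ?thesis by (simp add: power_mult_distrib)
qed

text \<open>Reduction of a binary form with matrix entries \<open>a\<close>, \<open>h\<close>,
  \<open>c\<close> and determinant 1, by induction on \<open>a\<close>. A shift makes
  \<open>2 * \<bar>h\<bar> \<le> a\<close>. If the new \<open>c\<close> is smaller than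
  \<open>a\<close>, the two basis vectors are exchanged; otherwise the form is already the sum of
  two squares.\<close>

lemma binary_gram_matrix:
  fixes a c h :: int
  assumes "a > 0" "a * c = h\<^sup>2 + 1"
  shows "\<exists>x1 x2 y1 y2. a = x1\<^sup>2 + x2\<^sup>2 \<and> c = y1\<^sup>2 + y2\<^sup>2 \<and> h = x1 * y1 + x2 * y2"
  using assms
proof (induction "nat a" arbitrary: a c h rule: less_induct)
  case less
  obtain k where k: "2 * \<bar>h + k * a\<bar> \<le> a" using balanced_residue[OF less.prems(1)] .
  define h' where "h' = h + k * a"
  \<comment> \<open>These are the Gram entries after \<open>k\<close> times the first basis vector
    is added to the second.\<close>
  define c' where "c' = c + 2 * k * h + k\<^sup>2 * a"
  \<comment> \<open>The unqualified name denotes a different method, from HOL-Algebra, in this context.\<close>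
  have eq: "a * c' = h'\<^sup>2 + 1"
    using less.prems(2) unfolding h'_def c'_def by Groebner_Basis.algebra
  have h': "4 * h'\<^sup>2 \<le> a\<^sup>2" using four_square_le k h'_def by blast
  have "a * c' > 0" using eq by (simp add: add_nonneg_pos)
  then have c'pos: "c' > 0" using less.prems(1) by (simp add: zero_less_mult_iff)
  have "\<exists>x1 x2 y1 y2. a = x1\<^sup>2 + x2\<^sup>2 \<and> c' = y1\<^sup>2 + y2\<^sup>2 \<and> h' = x1 * y1 + x2 * y2"
  proof (cases "c' < a")
    case True
    have "c' * a = h'\<^sup>2 + 1" using eq by (simp add: mult.commute)
    from less.hyps[OF _ c'pos this] True less.prems(1)
    obtain x1 x2 y1 y2 where "c' = x1\<^sup>2 + x2\<^sup>2" "a = y1\<^sup>2 + y2\<^sup>2" "h' = x1 * y1 + x2 * y2"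
      by auto
    then show ?thesis by (metis mult.commute)
  next
    case False
    \<comment> \<open>Now a^2 <= a c' = h'^2 + 1 <= a^2/4 + 1, which leaves only
      \<open>a = 1\<close>.\<close>
    have "a * a \<le> a * c'" using False less.prems(1) by (intro mult_left_mono) auto
    then have "3 * a\<^sup>2 \<le> 4" using eq h' by (simp add: power2_eq_square)
    then have "a\<^sup>2 < 2\<^sup>2" by simp
    then have "a < 2" using power2_less_imp_less[of a 2] by simp
    then have "a = 1" using less.prems(1) by simp
    then have "h' = 0" using k h'_def by presburger
    then have "c' = 1" using eq \<open>a = 1\<close> by simp
    show ?thesis using \<open>a = 1\<close> \<open>h' = 0\<close> \<open>c' = 1\<close>
      by (intro exI[of _ 1] exI[of _ 0]) auto
  qed
  then obtain x1 x2 y1 y2 where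
    xy: "a = x1\<^sup>2 + x2\<^sup>2" "c' = y1\<^sup>2 + y2\<^sup>2" "h' = x1 * y1 + x2 * y2" by blast
  \<comment> \<open>Subtracting \<open>k\<close> times the first vector from the second undoes the
    shift.\<close>
  have "h = x1 * (y1 - k * x1) + x2 * (y2 - k * x2)"
    using xy h'_def by Groebner_Basis.algebra
  moreover have "c = (y1 - k * x1)\<^sup>2 + (y2 - k * x2)\<^sup>2"
    using xy c'_def h'_def by Groebner_Basis.algebra
  ultimately show ?case using xy(1) by blast
qed

text \<open>
  The coefficients belong to the form \<open>a X\<^sup>2 + b Y\<^sup>2 + c Z\<^sup>2 + 2 r Y Z + 2 s X Z + 2 t X Y\<close>.
\<close>

definition ternary_gram :: "int \<Rightarrow> int \<Rightarrow> int \<Rightarrow> int \<Rightarrow> int \<Rightarrow> int \<Rightarrow> bool" where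
  "ternary_gram a b c r s t \<longleftrightarrow> (\<exists>x1 x2 x3 y1 y2 y3 z1 z2 z3.
     a = x1\<^sup>2 + x2\<^sup>2 + x3\<^sup>2 \<and> b = y1\<^sup>2 + y2\<^sup>2 + y3\<^sup>2 \<and> c = z1\<^sup>2 + z2\<^sup>2 + z3\<^sup>2 \<and>
     r = y1 * z1 + y2 * z2 + y3 * z3 \<and> s = x1 * z1 + x2 * z2 + x3 * z3 \<and>
     t = x1 * y1 + x2 * y2 + x3 * y3)"

lemma ternary_gram_swap12: "ternary_gram b a c s r t \<Longrightarrow> ternary_gram a b c r s t"
  unfolding ternary_gram_def by (metis mult.commute)

lemma ternary_gram_swap23: "ternary_gram a c b r t s \<Longrightarrow> ternary_gram a b c r s t"
  unfolding ternary_gram_def by (metis mult.commute)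

text \<open>The hypothesis is about the Gram matrix after \<open>k\<close> times the first vector is
  added to the second; replacing y by y - k x goes back. With the two exchanges and
  \<open>ternary_gram_shift23\<close> this supplies the basis changes of the reduction.\<close>

lemma ternary_gram_shift12:
  assumes "ternary_gram a (b + 2 * k * t + k\<^sup>2 * a) c (r + k * s) s (t + k * a)"
  shows "ternary_gram a b c r s t"
proof -
  from assms obtain x1 x2 x3 y1 y2 y3 z1 z2 z3 where *:
    "a = x1\<^sup>2 + x2\<^sup>2 + x3\<^sup>2" "b + 2 * k * t + k\<^sup>2 * a = y1\<^sup>2 + y2\<^sup>2 + y3\<^sup>2"
    "c = z1\<^sup>2 + z2\<^sup>2 + z3\<^sup>2" "r + k * s = y1 * z1 + y2 * z2 + y3 * z3"
    "s = x1 * z1 + x2 * z2 + x3 * z3" "t + k * a = x1 * y1 + x2 * y2 + x3 * y3"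
    unfolding ternary_gram_def by blast
  have "b = (y1 - k * x1)\<^sup>2 + (y2 - k * x2)\<^sup>2 + (y3 - k * x3)\<^sup>2"
    using *(1,2,6) by Groebner_Basis.algebra
  moreover have "r = (y1 - k * x1) * z1 + (y2 - k * x2) * z2 + (y3 - k * x3) * z3"
    using *(4,5) by Groebner_Basis.algebra
  moreover have "t = x1 * (y1 - k * x1) + x2 * (y2 - k * x2) + x3 * (y3 - k * x3)"
    using *(1,6) by Groebner_Basis.algebra
  ultimately show ?thesis
    unfolding ternary_gram_def using *(1,3,5) by blast
qed

lemma ternary_gram_shift23:
  assumes "ternary_gram a b (c + 2 * k * r + k\<^sup>2 * b) (r + k * b) (s + k * t) t"
  shows "ternary_gram a b c r s t"
proof -
  from assms obtain x1 x2 x3 y1 y2 y3 z1 z2 z3 where *: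
    "a = x1\<^sup>2 + x2\<^sup>2 + x3\<^sup>2" "b = y1\<^sup>2 + y2\<^sup>2 + y3\<^sup>2"
    "c + 2 * k * r + k\<^sup>2 * b = z1\<^sup>2 + z2\<^sup>2 + z3\<^sup>2" "r + k * b = y1 * z1 + y2 * z2 + y3 * z3"
    "s + k * t = x1 * z1 + x2 * z2 + x3 * z3" "t = x1 * y1 + x2 * y2 + x3 * y3"
    unfolding ternary_gram_def by blast
  have "c = (z1 - k * y1)\<^sup>2 + (z2 - k * y2)\<^sup>2 + (z3 - k * y3)\<^sup>2"
    using *(2,3,4) by Groebner_Basis.algebra
  moreover have "r = y1 * (z1 - k * y1) + y2 * (z2 - k * y2) + y3 * (z3 - k * y3)"
    using *(2,4) by Groebner_Basis.algebra
  moreover have "s = x1 * (z1 - k * y1) + x2 * (z2 - k * y2) + x3 * (z3 - k * y3)"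
    using *(5,6) by Groebner_Basis.algebra
  ultimately show ?thesis
    unfolding ternary_gram_def using *(1,2,6) by blast
qed

text \<open>Multiplying the form by \<open>a\<close> and completing the square leaves the binary
  form A Y^2 + 2 B Y Z + C Z^2, whose determinant A C - B^2 is \<open>a\<close> times the ternary
  one, hence \<open>a\<close>. The bounds on \<open>B\<close> and \<open>C\<close> give 3 A^2 <= 4
  a, those on \<open>t\<close> and \<open>b\<close> give 3 a^2 <= 4 A, and together they force a = A
  = 1.\<close>

lemma ternary_gram_reduced:
  fixes a b c r s t :: int
  assumes a: "a > 0" and A: "a * b - t\<^sup>2 > 0"
    and det: "a * b * c + 2 * r * s * t - a * r\<^sup>2 - b * s\<^sup>2 - c * t\<^sup>2 = 1"
    and t: "2 * \<bar>t\<bar> \<le> a" and "a \<le> b"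
    and B: "2 * \<bar>a * r - t * s\<bar> \<le> a * b - t\<^sup>2" and AC: "a * b - t\<^sup>2 \<le> a * c - s\<^sup>2"
  shows "ternary_gram a b c r s t"
proof -
  define A B C where "A = a * b - t\<^sup>2" and "B = a * r - t * s" and "C = a * c - s\<^sup>2"
  have detg: "A * C = a + B\<^sup>2" using det unfolding A_def B_def C_def by Groebner_Basis.algebra
  have "A * A \<le> A * C" using A AC unfolding A_def C_def by (intro mult_left_mono) auto
  moreover have "4 * B\<^sup>2 \<le> A\<^sup>2" using four_square_le B unfolding A_def B_def by blast
  ultimately have A2: "3 * A\<^sup>2 \<le> 4 * a" using detg by (simp add: power2_eq_square)
  have "a * a \<le> a * b" using \<open>a \<le> b\<close> a by (intro mult_left_mono) auto
  moreover have "4 * t\<^sup>2 \<le> a\<^sup>2" using four_square_le t by blast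
  ultimately have a2: "3 * a\<^sup>2 \<le> 4 * A" by (simp add: A_def power2_eq_square)
  \<comment> \<open>The larger of \<open>a\<close> and \<open>A\<close>, call it M, satisfies 3 M^2
    <= 4 M, so neither can reach 2.\<close>
  have "a < 2"
  proof (rule ccontr)
    assume "\<not> a < 2"
    have "a \<le> A"
    proof (rule ccontr)
      assume "\<not> a \<le> A"
      then have "3 * a\<^sup>2 < 4 * a" using a2 by linarith
      then have "3 * a < 4" using a by (simp add: power2_eq_square)
      then show False using \<open>\<not> a < 2\<close> by linarith
    qed
    then have "3 * A\<^sup>2 \<le> 4 * A" using A2 by linarith
    then have "A * (3 * A) \<le> A * 4" by (simp add: power2_eq_square)
    then have "3 * A \<le> 4" using A by (simp add: A_def[symmetric])
    then show False using \<open>a \<le> A\<close> \<open>\<not> a < 2\<close> by linarith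
  qed
  then have a1: "a = 1" using a by simp
  have "A\<^sup>2 < 2\<^sup>2" using A2 a1 by simp
  then have "A < 2" using power2_less_imp_less[of A 2] by simp
  then have A1: "A = 1" using A A_def by simp
  have "t = 0" using t a1 by simp
  have "b = 1" using A1 A_def a1 \<open>t = 0\<close> by simp
  have "r = 0" using B a1 \<open>b = 1\<close> \<open>t = 0\<close> by simp
  have "c = s\<^sup>2 + 1" using det a1 \<open>b = 1\<close> \<open>t = 0\<close> \<open>r = 0\<close> by simp
  then show ?thesis unfolding ternary_gram_def
    \<comment> \<open>The vectors are (1,0,0), (0,1,0) and (s,0,1); the entry \<open>s\<close> has
      not been reduced and may be nonzero.\<close>
    apply (simp only: a1 \<open>b = 1\<close> \<open>t = 0\<close> \<open>r = 0\<close>)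
    by (rule exI[of _ 1], rule exI[of _ 0], rule exI[of _ 0], rule exI[of _ 0], rule exI[of _ 1],
        rule exI[of _ 0], rule exI[of _ s], rule exI[of _ 0], rule exI[of _ 1]) simp
qed

text \<open>Two nested inductions, the outer on \<open>a\<close> and the inner on the minor A = a b
  - t^2 with \<open>a\<close> fixed. Exchanging the first two vectors lowers \<open>a\<close>;
  exchanging the last two keeps \<open>a\<close> and replaces \<open>A\<close> by C = a c - s^2.
  When neither exchange makes progress, the form is reduced.\<close>

lemma ternary_gram_matrix:
  fixes a b c r s t :: int
  assumes "a > 0" "a * b - t\<^sup>2 > 0"
    and "a * b * c + 2 * r * s * t - a * r\<^sup>2 - b * s\<^sup>2 - c * t\<^sup>2 = 1"
  shows "ternary_gram a b c r s t"
  using assms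
proof (induction "nat a" arbitrary: a b c r s t rule: less_induct)
  case outer: less
  show ?case
    \<comment> \<open>The outer induction hypothesis is carried as a premise through the inner
      induction, where it becomes \<open>IHa\<close>.\<close>
    using outer.prems outer.hyps
  proof (induction "nat (a * b - t\<^sup>2)" arbitrary: b c r s t rule: less_induct)
    case less
    note a = less.prems(1) and A = less.prems(2) and det = less.prems(3)
      and IHa = less.prems(4) and IHA = less.hyps
    obtain k where k: "2 * \<bar>t + k * a\<bar> \<le> a" using balanced_residue[OF a] .
    define t' b' r' where "t' = t + k * a" and "b' = b + 2 * k * t + k\<^sup>2 * a" and "r' = r + k * s"
    \<comment> \<open>The shift that reduces \<open>t\<close> modulo \<open>a\<close> preserves the
      minor, hence the inner induction measure.\<close>
    have A': "a * b' - t'\<^sup>2 = a * b - t\<^sup>2" unfolding t'_def b'_def by Groebner_Basis.algebra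
    have det': "a * b' * c + 2 * r' * s * t' - a * r'\<^sup>2 - b' * s\<^sup>2 - c * t'\<^sup>2 = 1"
      using det unfolding t'_def b'_def r'_def by Groebner_Basis.algebra
    have "a * b' > 0" using A A' zero_le_power2[of t'] by linarith
    then have b'pos: "b' > 0" using a by (simp add: zero_less_mult_iff)
    have "ternary_gram a b' c r' s t'"
    proof (cases "b' < a")
      case True
      have "b' * a - t'\<^sup>2 > 0" using A A' by (simp add: mult.commute)
      moreover have "b' * a * c + 2 * s * r' * t' - b' * s\<^sup>2 - a * r'\<^sup>2 - c * t'\<^sup>2 = 1"
        using det' by (simp add: algebra_simps)
      ultimately have "ternary_gram b' a c s r' t'"
        using IHa[of b' a t' c s r'] True b'pos by auto
      then show ?thesis by (rule ternary_gram_swap12)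
    next
      case ab: False
      define A where "A = a * b' - t'\<^sup>2"
      have Apos: "A > 0" using A A' A_def by simp
      \<comment> \<open>Adding \<open>m\<close> times the second vector to the third changes B = a r
        - t s by \<open>m * A\<close> and leaves \<open>a\<close>, \<open>b'\<close>,
        \<open>t'\<close> alone.\<close>
      obtain m where m: "2 * \<bar>(a * r' - t' * s) + m * A\<bar> \<le> A" using balanced_residue[OF Apos] .
      define c'' r'' s'' where "c'' = c + 2 * m * r' + m\<^sup>2 * b'" and "r'' = r' + m * b'"
        and "s'' = s + m * t'"
      have det'': "a * b' * c'' + 2 * r'' * s'' * t' - a * r''\<^sup>2 - b' * s''\<^sup>2 - c'' * t'\<^sup>2 = 1"
        using det' unfolding c''_def r''_def s''_def by Groebner_Basis.algebra
      have B: "2 * \<bar>a * r'' - t' * s''\<bar> \<le> A"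
      proof -
        have "a * r'' - t' * s'' = (a * r' - t' * s) + m * A"
          unfolding A_def r''_def s''_def by Groebner_Basis.algebra
        then show ?thesis using m by simp
      qed
      have "ternary_gram a b' c'' r'' s'' t'"
      proof (cases "a * c'' - s''\<^sup>2 < A")
        case True
        \<comment> \<open>The relation A C = a + B^2 gives C > 0, the positivity required after the
          last two vectors are exchanged.\<close>
        have "A * (a * c'' - s''\<^sup>2) = a + (a * r'' - t' * s'')\<^sup>2"
          using det'' unfolding A_def by Groebner_Basis.algebra
        then have "A * (a * c'' - s''\<^sup>2) > 0" using a by (simp add: add_pos_nonneg)
        then have C: "a * c'' - s''\<^sup>2 > 0" using Apos by (simp add: zero_less_mult_iff)
        have "a * c'' * b' + 2 * r'' * t' * s'' - a * r''\<^sup>2 - c'' * t'\<^sup>2 - b' * s''\<^sup>2 = 1"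
          using det'' by (simp add: algebra_simps)
        then have "ternary_gram a c'' b' r'' t' s''"
          using IHA[of c'' s'' b' r'' t'] True a C IHa A' A_def by auto
        then show ?thesis by (rule ternary_gram_swap23)
      next
        case False
        show ?thesis
          by (rule ternary_gram_reduced[OF a _ det'']) (use ab False Apos k B A_def t'_def in auto)
      qed
      then show ?thesis unfolding c''_def r''_def s''_def by (rule ternary_gram_shift23)
    qed
    then show ?case unfolding t'_def b'_def r'_def by (rule ternary_gram_shift12)
  qed
qed

section \<open>Principal minors and sums of three squares\<close>

text \<open>Lagrange's identity: \<bar>x\<bar>^2 \<bar>y\<bar>^2 - (x . y)^2 is the squared length
  of the cross product of x and y.\<close>

lemma minor_sum_three_squares:
  assumes "ternary_gram a b c r s t"
  shows "\<exists>x y z :: int. a * b - t\<^sup>2 = x\<^sup>2 + y\<^sup>2 + z\<^sup>2"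
proof -
  from assms obtain x1 x2 x3 y1 y2 y3 where *:
    "a = x1\<^sup>2 + x2\<^sup>2 + x3\<^sup>2" "b = y1\<^sup>2 + y2\<^sup>2 + y3\<^sup>2" "t = x1 * y1 + x2 * y2 + x3 * y3"
    unfolding ternary_gram_def by blast
  have "a * b - t\<^sup>2 = (x2 * y3 - x3 * y2)\<^sup>2 + (x3 * y1 - x1 * y3)\<^sup>2 + (x1 * y2 - x2 * y1)\<^sup>2"
    unfolding * by Groebner_Basis.algebra
  then show ?thesis by blast
qed

text \<open>Squarefree moduli suffice below, so no Hensel lifting is needed.\<close>

lemma QuadRes_squarefree:
  fixes m :: nat
  assumes "squarefree m" "\<And>p. prime p \<Longrightarrow> p dvd m \<Longrightarrow> QuadRes (int p) D"
  shows "QuadRes (int m) D"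
  using assms
proof (induction m rule: less_induct)
  case (less m)
  have "m \<noteq> 0" using less.prems(1) by (metis not_squarefree_0)
  show ?case
  proof (cases "m = 1")
    case True then show ?thesis by (simp add: QuadRes_def)
  next
    case False
    then obtain p where p: "prime p" "p dvd m" by (metis prime_factor_nat)
    then obtain k where k: "m = p * k" by blast
    have kpos: "k > 0" using \<open>m \<noteq> 0\<close> k by auto
    have "\<not> p dvd k"
    proof
      assume "p dvd k"
      then have "p\<^sup>2 dvd m" by (simp add: k power2_eq_square mult_dvd_mono)
      then have "p dvd 1" using less.prems(1) squarefreeD by blast
      then show False using p(1) by simp
    qed
    then have cop: "coprime (int p) (int k)" using p(1) by (simp add: prime_imp_coprime)
    have "squarefree k" using less.prems(1) k squarefree_multD by blast
    moreover have "k < m" using kpos k p(1) prime_gt_1_nat by simp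
    ultimately obtain y where y: "[y\<^sup>2 = D] (mod int k)"
      using less.IH[of k] less.prems(2) k unfolding QuadRes_def by auto
    obtain x where x: "[x\<^sup>2 = D] (mod int p)" using less.prems(2)[OF p] unfolding QuadRes_def by blast
    obtain z where z: "[z = x] (mod int p)" "[z = y] (mod int k)"
      using binary_chinese_remainder_int[OF cop] by blast
    have "[z\<^sup>2 = D] (mod int p)" using z(1) x cong_pow cong_trans by blast
    moreover have "[z\<^sup>2 = D] (mod int k)" using z(2) y cong_pow cong_trans by blast
    ultimately have "[z\<^sup>2 = D] (mod (int p * int k))" using cop by (rule coprime_cong_mult)
    then show ?thesis unfolding QuadRes_def k by auto
  qed
qed

text \<open>A root \<open>h\<close> of \<open>-N\<close> modulo \<open>A\<close> yields the binary
  form with entries \<open>A\<close>, \<open>h\<close>, \<open>c\<close> of determinant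
  \<open>N\<close>. The second residue condition yields \<open>t\<close> with A t^2 = -1 modulo
  \<open>N\<close>, that is \<open>int A * t\<^sup>2 + 1 = int N * d\<close>; bordering the binary
  form by \<open>t\<close>, \<open>0\<close> and \<open>d\<close> gives determinant N d - A t^2 =
  1.\<close>

lemma reciprocal_residues_imp_three_squares:
  fixes N A :: nat
  assumes "squarefree N" "squarefree A" "coprime A N"
    and "\<And>q. prime q \<Longrightarrow> q dvd A \<Longrightarrow> QuadRes (int q) (- int N)"
    and "\<And>p. prime p \<Longrightarrow> p dvd N \<Longrightarrow> QuadRes (int p) (- int A)"
  shows "\<exists>x y z :: int. int N = x\<^sup>2 + y\<^sup>2 + z\<^sup>2"
proof -
  have pos: "int A > 0" "int N > 0" using assms(1,2) by (metis gr0I not_squarefree_0 of_nat_0_less_iff)+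
  obtain h where "[h\<^sup>2 = - int N] (mod int A)"
    using QuadRes_squarefree assms(2,4) unfolding QuadRes_def by blast
  then have "int A dvd h\<^sup>2 + int N" by (simp add: cong_iff_dvd_diff)
  then obtain c where c: "h\<^sup>2 + int N = int A * c" by blast
  obtain x where x: "[x\<^sup>2 = - int A] (mod int N)"
    using QuadRes_squarefree assms(1,5) unfolding QuadRes_def by blast
  \<comment> \<open>With \<open>i\<close> inverse to \<open>A\<close> and x^2 = -A modulo
    \<open>N\<close>, the product t = x i satisfies A t^2 = -1.\<close>
  obtain i where i: "[int A * i = 1] (mod int N)"
    using assms(3) cong_solve_coprime_int[of "int A" "int N"] by auto
  define t where "t = x * i"
  have "[int A * t\<^sup>2 = (int A * i) * i * x\<^sup>2] (mod int N)"
    by (simp add: t_def power2_eq_square algebra_simps)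
  also have "[(int A * i) * i * x\<^sup>2 = 1 * i * (- int A)] (mod int N)"
    using i x by (intro cong_mult) auto
  also have "1 * i * (- int A) = (-1) * (int A * i)" by simp
  also have "[(-1) * (int A * i) = (-1) * 1] (mod int N)" using i by (intro cong_mult) auto
  finally have "int N dvd int A * t\<^sup>2 + 1" by (simp add: cong_iff_dvd_diff)
  then obtain d where d: "int A * t\<^sup>2 + 1 = int N * d" by blast
  have N: "int A * c - h\<^sup>2 = int N" using c by simp
  have "int A * c * d - int A * t\<^sup>2 - d * h\<^sup>2 = 1"
    using d N by Groebner_Basis.algebra
  then have "ternary_gram (int A) c d t 0 h"
    using ternary_gram_matrix[of "int A" c h d t 0] pos N by simp
  then show ?thesis using minor_sum_three_squares N by metis
qed

section \<open>Real characters and the hyperbola method\<close>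

text \<open>A real Dirichlet character modulo \<open>M\<close>, possibly principal or imprimitive.
  That a character is nonprincipal is expressed below by exhibiting an argument with value
  -1.\<close>

definition real_character :: "nat \<Rightarrow> (nat \<Rightarrow> int) \<Rightarrow> bool" where
  "real_character M f \<longleftrightarrow>
     (\<forall>m n. f (m * n) = f m * f n) \<and> (\<forall>n. f (n + M) = f n) \<and>
     (\<forall>n. coprime n M \<longrightarrow> f n = 1 \<or> f n = -1) \<and> (\<forall>n. \<not> coprime n M \<longrightarrow> f n = 0)"

lemma real_characterD:
  assumes "real_character M f"
  shows "f (m * n) = f m * f n" "f (n + M) = f n" "coprime n M \<Longrightarrow> f n = 1 \<or> f n = -1"
    "\<not> coprime n M \<Longrightarrow> f n = 0"
  using assms unfolding real_character_def by auto

lemma real_character_one [simp]: "real_character M f \<Longrightarrow> f (Suc 0) = 1"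
  using real_characterD(1)[of M f 1 1] real_characterD(3)[of M f 1] by auto

lemma real_character_abs_le: "real_character M f \<Longrightarrow> \<bar>f n\<bar> \<le> 1"
  using real_characterD(3,4)[of M f n] by fastforce

lemma real_character_power: "real_character M f \<Longrightarrow> f (p ^ k) = f p ^ k"
  by (induction k) (auto simp: real_characterD(1))

lemma real_character_add_mult: "real_character M f \<Longrightarrow> f (n + k * M) = f n"
proof (induction k)
  case (Suc k)
  then show ?case using real_characterD(2)[of M f "n + k * M"] by (simp add: algebra_simps)
qed simp

lemma real_character_mod: "real_character M f \<Longrightarrow> f (n mod M) = f n"
  using real_character_add_mult[of M f "n mod M" "n div M"] by simp

lemma real_character_mult:
  assumes "real_character M f" "real_character M g"
  shows "real_character M (\<lambda>n. f n * g n)"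
proof -
  have "f n * g n = 1 \<or> f n * g n = -1" if "coprime n M" for n
    using real_characterD(3)[OF assms(1) that] real_characterD(3)[OF assms(2) that] by auto
  then show ?thesis
    using real_characterD(1,2,4)[OF assms(1)] real_characterD(1,2,4)[OF assms(2)]
    unfolding real_character_def by simp
qed

text \<open>Multiplication by \<open>b\<close> permutes the residues modulo \<open>M\<close> and
  turns the sum into its negative.\<close>

lemma real_character_sum_period:
  assumes f: "real_character M f" and "M > 0" and b: "f b = -1"
  shows "(\<Sum>n<M. f n) = 0"
proof -
  have cop: "coprime b M" using b real_characterD(4)[OF f, of b] by (cases "coprime b M") auto
  have "bij_betw (\<lambda>n. (b * n) mod M) {..<M} {..<M}"
  proof (rule bij_betwI')
    fix x y assume "x \<in> {..<M}" "y \<in> {..<M}"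
    then show "(b * x mod M = b * y mod M) = (x = y)"
      using cong_mult_lcancel_nat[of b M x y] cop unfolding cong_def by simp
  next
    fix y assume y: "y \<in> {..<M}"
    obtain i where "[b * i = 1] (mod M)" using cong_solve_coprime_nat[OF cop] by auto
    then have "[b * i * y = 1 * y] (mod M)" by (intro cong_mult) auto
    then have "b * ((i * y) mod M) mod M = y" using y
      by (simp add: cong_def mod_mult_right_eq mult.assoc)
    then show "\<exists>x\<in>{..<M}. y = b * x mod M" using assms(2) by (intro bexI[of _ "(i * y) mod M"]) auto
  qed (use assms(2) in auto)
  then have "(\<Sum>n<M. f n) = (\<Sum>n<M. f ((b * n) mod M))"
    by (rule sum.reindex_bij_betw[symmetric])
  also have "\<dots> = (\<Sum>n<M. - f n)"
    by (simp add: real_character_mod[OF f] real_characterD(1)[OF f] b)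
  also have "\<dots> = - (\<Sum>n<M. f n)" by (rule sum_negf)
  finally show ?thesis by simp
qed

text \<open>Full periods contribute 0, and fewer than \<open>M\<close> terms remain.\<close>

lemma real_character_sum_lessThan_bound:
  assumes f: "real_character M f" and "M > 0" and b: "f b = -1"
  shows "\<bar>\<Sum>n<x. f n\<bar> \<le> int M"
proof (induction x rule: less_induct)
  case (less x)
  show ?case
  proof (cases "x < M")
    case True
    have "\<bar>\<Sum>n<x. f n\<bar> \<le> (\<Sum>n<x. 1)"
      using real_character_abs_le[OF f] by (intro order_trans[OF sum_abs] sum_mono)
    then show ?thesis using True by simp
  next
    case False
    define x' where "x' = x - M"
    have x: "x = M + x'" using False x'_def by simp
    have "(\<Sum>n<x. f n) = (\<Sum>n<M. f n) + (\<Sum>n\<in>{M..<x}. f n)"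
      unfolding lessThan_atLeast0 using False by (intro sum.atLeastLessThan_concat[symmetric]) auto
    also have "(\<Sum>n\<in>{M..<x}. f n) = (\<Sum>n<x'. f (n + M))"
      unfolding x lessThan_atLeast0 using sum.shift_bounds_nat_ivl[of f 0 M x'] by (simp add: add.commute)
    also have "\<dots> = (\<Sum>n<x'. f n)" by (simp add: real_characterD(2)[OF f])
    finally have "(\<Sum>n<x. f n) = (\<Sum>n<x'. f n)"
      using real_character_sum_period[OF assms] by simp
    then show ?thesis using less.IH[of x'] x assms(2) by simp
  qed
qed

lemma real_character_sum_bound:
  assumes f: "real_character M f" and "M > 0" and b: "f b = -1"
  shows "\<bar>\<Sum>n\<in>{m<..k}. f n\<bar> \<le> 2 * int M"
proof (cases "m \<le> k")
  case True
  have "(\<Sum>n<Suc k. f n) = (\<Sum>n<Suc m. f n) + (\<Sum>n\<in>{Suc m..<Suc k}. f n)"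
    unfolding lessThan_atLeast0 using True by (intro sum.atLeastLessThan_concat[symmetric]) auto
  moreover have "{Suc m..<Suc k} = {m<..k}" by auto
  ultimately show ?thesis
    using real_character_sum_lessThan_bound[OF assms, of "Suc k"]
      real_character_sum_lessThan_bound[OF assms, of "Suc m"] by auto
qed (use assms(2) in auto)

section \<open>Partial summation\<close>

lemma abel_summation_bound:
  fixes f w :: "nat \<Rightarrow> real"
  assumes "m \<le> k" and w: "\<And>n. n > m \<Longrightarrow> w n \<ge> 0" "\<And>n. n > m \<Longrightarrow> w (Suc n) \<le> w n"
    and C: "\<And>k. \<bar>\<Sum>n\<in>{m<..k}. f n\<bar> \<le> C"
  shows "\<bar>\<Sum>n\<in>{m<..k}. f n * w n\<bar> \<le> C * w (Suc m)"
proof -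
  define F where "F k = (\<Sum>n\<in>{m<..k}. f n)" for k
  \<comment> \<open>Removing the boundary term leaves D k as the sum of F n (w n - w (n+1)) over m <
    n <= k, and since \<open>w\<close> decreases the bounds telescope.\<close>
  define D where "D k = (\<Sum>n\<in>{m<..k}. f n * w n) - F k * w (Suc k)" for k
  have "\<bar>D k\<bar> \<le> C * (w (Suc m) - w (Suc k))"
    using \<open>m \<le> k\<close>
  proof (induction k rule: dec_induct)
    case base
    show ?case by (simp add: D_def F_def)
  next
    case (step k)
    have set: "{m<..Suc k} = insert (Suc k) {m<..k}" using step.hyps by auto
    have FS: "F (Suc k) = F k + f (Suc k)" unfolding F_def set by simp
    have "D (Suc k) = D k + F (Suc k) * (w (Suc k) - w (Suc (Suc k)))"
      unfolding D_def FS set by (simp add: algebra_simps)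
    moreover have "\<bar>F (Suc k) * (w (Suc k) - w (Suc (Suc k)))\<bar> \<le> C * (w (Suc k) - w (Suc (Suc k)))"
      unfolding abs_mult using C[of "Suc k"] w(2)[of "Suc k"] step.hyps
      by (simp add: F_def mult_right_mono)
    ultimately show ?case using step.IH by (simp add: algebra_simps)
  qed
  moreover have "\<bar>F k * w (Suc k)\<bar> \<le> C * w (Suc k)"
    unfolding abs_mult using C[of k] w(1)[of "Suc k"] \<open>m \<le> k\<close>
    by (simp add: F_def mult_right_mono)
  ultimately show ?thesis unfolding D_def by (simp add: algebra_simps)
qed

lemma sum_inverse_sqrt_le: "(\<Sum>a\<in>{0<..y}. 1 / sqrt (real a)) \<le> 2 * sqrt (real y)"
proof (induction y)
  case (Suc y)
  have "{0<..Suc y} = insert (Suc y) {0<..y}" by auto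
  then have "(\<Sum>a\<in>{0<..Suc y}. 1 / sqrt (real a)) \<le> 1 / sqrt (Suc y) + 2 * sqrt y"
    using Suc.IH by simp
  also have "\<dots> \<le> 2 * sqrt (Suc y)"
  proof -
    \<comment> \<open>After multiplication by \<open>sqrt (Suc y)\<close> the claim is equivalent to
      the nonnegativity of this square.\<close>
    have "0 \<le> (sqrt (Suc y) - sqrt y)\<^sup>2" by simp
    also have "\<dots> = real (Suc y) + real y - 2 * sqrt (Suc y) * sqrt y"
      by (simp add: power2_diff)
    finally have "1 + 2 * sqrt y * sqrt (Suc y) \<le> 2 * sqrt (Suc y) * sqrt (Suc y)"
      by (simp add: algebra_simps)
    then show ?thesis by (simp add: field_simps)
  qed
  finally show ?case .
qed simp

section \<open>Dirichlet's hyperbola method\<close>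

definition hyperbola :: "nat \<Rightarrow> (nat \<times> nat) set" where
  "hyperbola y = {(a, b). a > 0 \<and> b > 0 \<and> a * b \<le> y}"

lemma finite_hyperbola [simp]: "finite (hyperbola y)"
proof (rule finite_subset)
  show "hyperbola y \<subseteq> {..y} \<times> {..y}"
  proof
    fix z assume "z \<in> hyperbola y"
    then obtain a b where "z = (a, b)" "a > 0" "b > 0" "a * b \<le> y" by (auto simp: hyperbola_def)
    moreover from this have "a \<le> a * b" "b \<le> a * b" by auto
    ultimately have "z = (a, b)" "a \<le> y" "b \<le> y" by linarith+
    then show "z \<in> {..y} \<times> {..y}" by auto
  qed
qed auto

lemma sum_hyperbola_by_product:
  "(\<Sum>(a, b)\<in>hyperbola y. h a b) = (\<Sum>n\<in>{0<..y}. \<Sum>d | d dvd n. h d (n div d))"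
proof -
  have "(\<Sum>n\<in>{0<..y}. \<Sum>d | d dvd n. h d (n div d))
      = (\<Sum>(n, d)\<in>(SIGMA n:{0<..y}. {d. d dvd n}). h d (n div d))"
    by (rule sum.Sigma) auto
  also have "\<dots> = (\<Sum>(a, b)\<in>hyperbola y. h a b)"
    by (rule sum.reindex_bij_witness[of _ "\<lambda>(a, b). (a * b, a)" "\<lambda>(n, d). (d, n div d)"])
      (auto simp: hyperbola_def dvd_pos_nat)
  finally show ?thesis by simp
qed

text \<open>Since a b <= y^2, at most one coordinate exceeds \<open>y\<close>. The region is
  therefore a full square together with two arms, one for \<open>b > y\<close> and its mirror image
  for \<open>a > y\<close>.\<close>

lemma hyperbola_square_split:
  fixes h :: "nat \<Rightarrow> nat \<Rightarrow> real"
  shows "(\<Sum>(a, b)\<in>hyperbola (y * y). h a b) =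
    (\<Sum>a\<in>{0<..y}. \<Sum>b\<in>{0<..y}. h a b)
    + (\<Sum>a\<in>{0<..y}. \<Sum>b\<in>{y<..y * y div a}. h a b)
    + (\<Sum>b\<in>{0<..y}. \<Sum>a\<in>{y<..y * y div b}. h a b)"
proof -
  define A where "A = {0<..y} \<times> {0<..y}"
  define B where "B = (SIGMA a:{0<..y}. {y<..y * y div a})"
  define C where "C = (\<lambda>(b, a). (a, b)) ` B"
  have le: "a \<le> y \<or> b \<le> y" if "a * b \<le> y * y" for a b
    using that mult_strict_mono'[of y a y b] by linarith
  have div: "b \<le> y * y div a \<longleftrightarrow> a * b \<le> y * y" if "a > 0" for a b
    using that by (simp add: less_eq_div_iff_mult_less_eq mult.commute)
  have "hyperbola (y * y) = A \<union> B \<union> C"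
  proof (intro equalityI subsetI)
    fix z assume "z \<in> hyperbola (y * y)"
    then obtain a b where z: "z = (a, b)" "a > 0" "b > 0" "a * b \<le> y * y"
      by (auto simp: hyperbola_def)
    consider "a \<le> y" "b \<le> y" | "a \<le> y" "y < b" | "b \<le> y" "y < a" using le[OF z(4)] by linarith
    then show "z \<in> A \<union> B \<union> C"
      by cases (use z in \<open>auto simp: A_def B_def C_def div image_iff mult.commute\<close>)
  next
    fix z assume "z \<in> A \<union> B \<union> C"
    then show "z \<in> hyperbola (y * y)"
      by (auto simp: A_def B_def C_def hyperbola_def div mult_mono' mult.commute)
  qed
  moreover have "finite A" "finite B" "finite C" unfolding A_def B_def C_def by auto
  moreover have "A \<inter> B = {}" "(A \<union> B) \<inter> C = {}" unfolding A_def B_def C_def by auto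
  moreover have "(\<Sum>(a, b)\<in>C. h a b) = (\<Sum>(b, a)\<in>B. h a b)"
    unfolding C_def by (subst sum.reindex) (auto simp: inj_on_def case_prod_unfold)
  ultimately have "(\<Sum>(a, b)\<in>hyperbola (y * y). h a b) =
      (\<Sum>(a, b)\<in>A. h a b) + (\<Sum>(a, b)\<in>B. h a b) + (\<Sum>(b, a)\<in>B. h a b)"
    by (simp add: sum.union_disjoint)
  then show ?thesis unfolding A_def B_def
    by (simp add: sum.Sigma sum.cartesian_product)
qed

text \<open>Put C = 2 M. On the square the sum is a product of two factors, each at most C in
  absolute value. On an arm the inner sum starts beyond \<open>y\<close> and is at most C / sqrt
  (y+1) by partial summation, while the outer weights add up to at most 2 sqrt y, so an arm
  contributes at most 2 C. The total C^2 + 4 C does not depend on \<open>y\<close>.\<close>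

lemma hyperbola_character_sum_bound:
  fixes f g :: "nat \<Rightarrow> int"
  assumes f: "real_character M f" "f b = -1" and g: "real_character M g" "g c = -1" and M: "M > 0"
  shows "\<bar>\<Sum>(a, b)\<in>hyperbola (y * y). f a * g b / sqrt (a * b)\<bar> \<le> 4 * real M ^ 2 + 8 * real M"
proof -
  define C where "C = 2 * real M"
  define w where "w n = 1 / sqrt (real n)" for n
  have w: "w n \<ge> 0" "n > 0 \<Longrightarrow> w (Suc n) \<le> w n" for n
    by (auto simp: w_def intro!: divide_left_mono mult_pos_pos)
  have Cf: "\<bar>\<Sum>n\<in>{m<..k}. real_of_int (h n)\<bar> \<le> C" if "real_character M h" "h e = -1" for m k e h
  proof -
    have "real_of_int \<bar>\<Sum>n\<in>{m<..k}. h n\<bar> \<le> real_of_int (2 * int M)"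
      using real_character_sum_bound[OF that(1) M that(2)] by (subst of_int_le_iff)
    then show ?thesis by (simp add: C_def)
  qed
  have tail: "\<bar>\<Sum>n\<in>{m<..k}. real_of_int (h n) * w n\<bar> \<le> C * w (Suc m)"
    if "real_character M h" "h e = -1" for m k e h
  proof (cases "m \<le> k")
    case True
    then show ?thesis using w Cf[OF that] by (intro abel_summation_bound) auto
  next
    case False
    then show ?thesis using w(1)[of "Suc m"] by (simp add: C_def)
  qed
  \<comment> \<open>One arm of the region; it is applied to \<open>f\<close> and \<open>g\<close> in
    both orders.\<close>
  have side: "\<bar>\<Sum>a\<in>{0<..y}. real_of_int (k a) * w a * (\<Sum>b\<in>{y<..y * y div a}. real_of_int (h b) * w b)\<bar> \<le> 2 * C"
    if k: "real_character M k" and h: "real_character M h" "h e = -1" for k h e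
  proof -
    have "\<bar>\<Sum>a\<in>{0<..y}. real_of_int (k a) * w a * (\<Sum>b\<in>{y<..y * y div a}. real_of_int (h b) * w b)\<bar>
      \<le> (\<Sum>a\<in>{0<..y}. w a * (C * w (Suc y)))"
    proof (rule order_trans[OF sum_abs], rule sum_mono)
      fix a
      have "\<bar>real_of_int (k a)\<bar> \<le> 1" using real_character_abs_le[OF k, of a] by linarith
      then have "\<bar>real_of_int (k a)\<bar> * w a \<le> 1 * w a" using w(1) by (intro mult_right_mono)
      then show "\<bar>real_of_int (k a) * w a * (\<Sum>b\<in>{y<..y * y div a}. real_of_int (h b) * w b)\<bar>
        \<le> w a * (C * w (Suc y))"
        unfolding abs_mult using tail[OF h, of y "y * y div a"] w(1)[of a]
        by (intro mult_mono) auto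
    qed
    also have "\<dots> = (\<Sum>a\<in>{0<..y}. w a) * (C * w (Suc y))" by (simp add: sum_distrib_right)
    also have "\<dots> \<le> (2 * sqrt y) * (C * w (Suc y))"
      using sum_inverse_sqrt_le[of y] w(1)[of "Suc y"]
      by (intro mult_right_mono) (auto simp: w_def C_def)
    also have "\<dots> = 2 * C * (sqrt y / sqrt (Suc y))" by (simp add: w_def)
    also have "\<dots> \<le> 2 * C * 1" by (intro mult_left_mono) (auto simp: C_def)
    finally show ?thesis by simp
  qed
  have "(\<Sum>(a, b)\<in>hyperbola (y * y). f a * g b / sqrt (a * b))
      = (\<Sum>(a, b)\<in>hyperbola (y * y). (f a * w a) * (g b * w b))"
    by (intro sum.cong) (auto simp: w_def real_sqrt_mult)
  also have "\<dots> = (\<Sum>a\<in>{0<..y}. f a * w a) * (\<Sum>b\<in>{0<..y}. g b * w b)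
     + (\<Sum>a\<in>{0<..y}. f a * w a * (\<Sum>b\<in>{y<..y * y div a}. g b * w b))
     + (\<Sum>b\<in>{0<..y}. g b * w b * (\<Sum>a\<in>{y<..y * y div b}. f a * w a))"
    unfolding hyperbola_square_split sum_product
    by (simp add: sum_distrib_left sum_distrib_right mult_ac)
  finally have eq: "(\<Sum>(a, b)\<in>hyperbola (y * y). f a * g b / sqrt (a * b)) = \<dots>" .
  have "\<bar>(\<Sum>a\<in>{0<..y}. f a * w a) * (\<Sum>b\<in>{0<..y}. g b * w b)\<bar> \<le> C * C"
    unfolding abs_mult using tail[OF f, of 0 y] tail[OF g, of 0 y]
    by (intro mult_mono) (auto simp: w_def C_def)
  then show ?thesis
    unfolding eq using side[OF f(1) g] side[OF g(1) f]
    by (auto simp: C_def power2_eq_square)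
qed

section \<open>Divisor sums of a real character\<close>

text \<open>Splits off the full power of one prime, the step on which the inductions along
  multiplicativity rest.\<close>

lemma prime_power_times_rest:
  fixes n :: nat
  assumes "n > 1"
  obtains p k m where "prime p" "\<not> p dvd m" "n = p ^ k * m" "k > 0" "m > 0" "m < n"
proof -
  obtain p where p: "prime p" "p dvd n" using assms by (metis prime_factor_nat less_irrefl)
  define k where "k = multiplicity p n"
  have n: "n \<noteq> 0" using assms by simp
  then obtain m where m: "n = p ^ k * m" "\<not> p dvd m"
    unfolding k_def using multiplicity_decompose'[of n p] p(1) not_prime_unit by metis
  have k: "k > 0" unfolding k_def using p n by (simp add: prime_multiplicity_gt_zero_iff)
  have mpos: "m > 0" using m(2) by (cases m) auto
  have "1 < p ^ k" using k p(1) prime_gt_1_nat by (metis one_less_power)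
  then have "1 * m < p ^ k * m" using mpos by (intro mult_strict_right_mono)
  then show thesis using that[OF p(1) m(2,1) k mpos] m(1) by simp
qed

text \<open>Every divisor of \<open>p ^ k * m\<close> is \<open>p ^ i * d\<close> for exactly one
  \<open>i \<le> k\<close> and one divisor \<open>d\<close> of \<open>m\<close>, so the sum
  factors.\<close>

lemma divisor_sum_prime_power_mult:
  fixes p k m :: nat
  assumes f: "real_character M f" and p: "prime p" and m: "\<not> p dvd m"
  shows "(\<Sum>d | d dvd p ^ k * m. f d) = (\<Sum>i\<le>k. f p ^ i) * (\<Sum>d | d dvd m. f d)"
proof -
  have "bij_betw (\<lambda>(i, d). p ^ i * d) ({..k} \<times> {d. d dvd m}) {d. d dvd p ^ k * m}"
  proof (rule bij_betwI')
    fix x y assume x: "x \<in> {..k} \<times> {d. d dvd m}" and y: "y \<in> {..k} \<times> {d. d dvd m}"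
    obtain i d j e where xy: "x = (i, d)" "y = (j, e)" by fastforce
    have nd: "\<not> p dvd d" "\<not> p dvd e" using x y xy m dvd_trans by auto
    have mult: "multiplicity p (p ^ i * d) = i" if "\<not> p dvd d" for i d
      using p that by (intro multiplicity_eqI) (auto simp: prime_gt_0_nat)
    have "i = j" if "p ^ i * d = p ^ j * e" using mult nd that by metis
    then show "((case x of (i, d) \<Rightarrow> p ^ i * d) = (case y of (i, d) \<Rightarrow> p ^ i * d)) = (x = y)"
      using p xy by (auto simp: prime_gt_0_nat)
  next
    fix x assume "x \<in> {..k} \<times> {d. d dvd m}"
    then show "(case x of (i, d) \<Rightarrow> p ^ i * d) \<in> {d. d dvd p ^ k * m}"
      by (auto intro!: mult_dvd_mono le_imp_power_dvd)
  next
    fix d assume "d \<in> {d. d dvd p ^ k * m}"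
    then obtain x e where "d = x * e" "x dvd p ^ k" "e dvd m"
      using division_decomp[of d "p ^ k" m] by auto
    moreover from this obtain i where "i \<le> k" "x = p ^ i" using divides_primepow_nat[OF p] by auto
    ultimately show "\<exists>y\<in>{..k} \<times> {d. d dvd m}. d = (case y of (i, d) \<Rightarrow> p ^ i * d)"
      by (intro bexI[of _ "(i, e)"]) auto
  qed
  then have "(\<Sum>d | d dvd p ^ k * m. f d) = (\<Sum>(i, d)\<in>{..k} \<times> {d. d dvd m}. f (p ^ i * d))"
    by (subst sum.reindex_bij_betw[symmetric]) (auto simp: case_prod_unfold)
  also have "\<dots> = (\<Sum>i\<le>k. f p ^ i) * (\<Sum>d | d dvd m. f d)"
    unfolding sum_product sum.cartesian_product
    by (simp add: real_characterD(1)[OF f] real_character_power[OF f])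
  finally show ?thesis .
qed

lemma sum_powers_minus_one: "(\<Sum>i\<le>k. (- 1 :: int) ^ i) = (if even k then 1 else 0)"
  by (induction k) auto

text \<open>These sums are the local factors of the divisor sum: \<open>k + 1\<close> for
  \<open>e = 1\<close>; for \<open>e = -1\<close>, 1 or 0 as \<open>k\<close> is even or
  odd.\<close>

lemma sum_powers_sign:
  fixes e :: int
  assumes "e = 1 \<or> e = -1"
  shows "(\<Sum>i\<le>k. e ^ i) \<ge> 0" "even k \<Longrightarrow> (\<Sum>i\<le>k. e ^ i) \<ge> 1"
    "(\<Sum>i\<le>k. e ^ i) \<noteq> 0 \<Longrightarrow> odd k \<Longrightarrow> e = 1"
  using assms by (auto simp: sum_powers_minus_one)

text \<open>All local factors are nonnegative, and one of them vanishes exactly when f p = -1 and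
  the exponent of \<open>p\<close> is odd. If none vanishes, the primes of odd exponent make up
  \<open>a\<close>, and \<open>f\<close> is 1 at each of them.\<close>

lemma divisor_sum_support:
  fixes n :: nat
  assumes f: "real_character M f" and "n > 0" "coprime n M"
  shows "(\<Sum>d | d dvd n. f d) \<ge> 0 \<and> ((\<Sum>d | d dvd n. f d) \<noteq> 0 \<longrightarrow>
    (\<exists>a k. n = a * k\<^sup>2 \<and> squarefree a \<and> (\<forall>q. prime q \<longrightarrow> q dvd a \<longrightarrow> f q = 1)))"
  using assms(2,3)
proof (induction n rule: less_induct)
  case (less n)
  show ?case
  proof (cases "n = 1")
    case True
    have "(\<Sum>d | d dvd n. f d) = 1" using f True by simp
    then show ?thesis using True by (intro conjI impI exI[of _ 1]) auto
  next
    case False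
    then have "n > 1" using less.prems(1) by simp
    then obtain p k m where p: "prime p" and m: "\<not> p dvd m" and n: "n = p ^ k * m"
      and "k > 0" and mpos: "m > 0" and "m < n"
      by (rule prime_power_times_rest)
    have copm: "coprime m M" "coprime p M" using less.prems(2) n \<open>k > 0\<close> by auto
    have fp: "f p = 1 \<or> f p = -1" using real_characterD(3)[OF f copm(2)] .
    define s where "s = (\<Sum>i\<le>k. f p ^ i)"
    have r: "(\<Sum>d | d dvd n. f d) = s * (\<Sum>d | d dvd m. f d)"
      unfolding s_def n by (rule divisor_sum_prime_power_mult[OF f p m])
    note IH = less.IH[OF \<open>m < n\<close> mpos copm(1)]
    note s = sum_powers_sign[OF fp, of k, folded s_def]
    have "\<exists>a k. n = a * k\<^sup>2 \<and> squarefree a \<and> (\<forall>q. prime q \<longrightarrow> q dvd a \<longrightarrow> f q = 1)"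
      if nz: "(\<Sum>d | d dvd n. f d) \<noteq> 0"
    proof -
      obtain a j where a: "m = a * j\<^sup>2" "squarefree a" "\<And>q. prime q \<Longrightarrow> q dvd a \<Longrightarrow> f q = 1"
        using IH nz r by auto
      show ?thesis
      proof (cases "even k")
        case True
        then obtain i where "k = 2 * i" by blast
        then have "n = a * (p ^ i * j)\<^sup>2"
          unfolding n a(1) by (simp add: power_mult_distrib power_mult[symmetric] mult.commute)
        then show ?thesis using a by blast
      next
        case False
        then obtain i where "k = 2 * i + 1" by (rule oddE)
        \<comment> \<open>For an odd exponent one copy of \<open>p\<close> joins the squarefree
          factor, the remaining ones join the square.\<close>
        then have "n = (p * a) * (p ^ i * j)\<^sup>2"
          unfolding n a(1) by (simp add: power_mult_distrib power_mult[symmetric] mult.commute)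
        moreover have "f p = 1" using s(3) nz r False by auto
        moreover have "\<not> p dvd a" using m a(1) by auto
        then have "squarefree (p * a)"
          using a(2) p by (intro squarefree_mult_coprime) (auto simp: prime_imp_coprime squarefree_prime)
        moreover have "f q = 1" if "prime q" "q dvd p * a" for q
          using that a(3) \<open>f p = 1\<close> p by (metis prime_dvd_mult_iff primes_dvd_imp_eq)
        ultimately show ?thesis by blast
      qed
    qed
    then show ?thesis using r IH s(1) by simp
  qed
qed

text \<open>All exponents of a square are even, so every local factor is at least 1.\<close>

lemma divisor_sum_square_ge_1:
  fixes n :: nat
  assumes f: "real_character M f" and "n > 0" "coprime n M"
  shows "(\<Sum>d | d dvd n\<^sup>2. f d) \<ge> 1"
  using assms(2,3)
proof (induction n rule: less_induct)
  case (less n)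
  show ?case
  proof (cases "n = 1")
    case True
    then show ?thesis using f by auto
  next
    case False
    then have "n > 1" using less.prems(1) by simp
    then obtain p k m where p: "prime p" and m: "\<not> p dvd m" and n: "n = p ^ k * m"
      and "k > 0" and mpos: "m > 0" and "m < n"
      by (rule prime_power_times_rest)
    have copm: "coprime m M" "coprime p M" using less.prems(2) n \<open>k > 0\<close> by auto
    have "n\<^sup>2 = p ^ (2 * k) * m\<^sup>2" using n by (simp add: power_mult_distrib power_mult[symmetric] mult.commute)
    moreover have "\<not> p dvd m\<^sup>2" using m p prime_dvd_power by blast
    ultimately have "(\<Sum>d | d dvd n\<^sup>2. f d) = (\<Sum>i\<le>2 * k. f p ^ i) * (\<Sum>d | d dvd m\<^sup>2. f d)"
      using divisor_sum_prime_power_mult[OF f p] by simp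
    moreover have "(\<Sum>i\<le>2 * k. f p ^ i) \<ge> 1"
      by (rule sum_powers_sign(2)[OF real_characterD(3)[OF f copm(2)]]) simp
    moreover have "(\<Sum>d | d dvd m\<^sup>2. f d) \<ge> 1" by (rule less.IH[OF \<open>m < n\<close> mpos copm(1)])
    ultimately show ?thesis using mult_mono[of 1 "\<Sum>i\<le>2 * k. f p ^ i" 1 "\<Sum>d | d dvd m\<^sup>2. f d"] by simp
  qed
qed

section \<open>Divergence of the principal term\<close>

lemma ln_le_harmonic_sum: "ln (real (Suc n)) \<le> (\<Sum>j<n. 1 / real (Suc j))"
proof (induction n)
  case (Suc n)
  have "real (Suc (Suc n)) = real (Suc n) * (1 + 1 / real (Suc n))" by (simp add: field_simps)
  then have "ln (real (Suc (Suc n))) = ln (real (Suc n)) + ln (1 + 1 / real (Suc n))"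
    by (simp only:) (rule ln_mult_pos, auto simp: add_pos_pos)
  also have "\<dots> \<le> (\<Sum>j<n. 1 / real (Suc j)) + 1 / real (Suc n)"
    by (intro add_mono Suc.IH ln_add_one_self_le_self) simp
  finally show ?case by simp
qed simp

definition principal_character :: "nat \<Rightarrow> nat \<Rightarrow> int" where
  "principal_character M n = (if coprime n M then 1 else 0)"

lemma real_character_principal: "real_character M (principal_character M)"
proof -
  have "coprime (n + M) M \<longleftrightarrow> coprime n M" for n
    unfolding coprime_iff_gcd_eq_1 by simp
  then show ?thesis by (auto simp: real_character_def principal_character_def)
qed

text \<open>The principal factor keeps this a character modulo \<open>M\<close> even for
  \<open>S = {}\<close>, which is the index of the main term when the product over all signs is
  expanded.\<close>

definition product_character :: "nat \<Rightarrow> ('a \<Rightarrow> nat \<Rightarrow> int) \<Rightarrow> 'a set \<Rightarrow> nat \<Rightarrow> int" where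
  "product_character M \<phi> S n = principal_character M n * (\<Prod>p\<in>S. \<phi> p n)"

lemma real_character_product:
  assumes "finite S" "\<And>p. p \<in> S \<Longrightarrow> real_character M (\<phi> p)"
  shows "real_character M (product_character M \<phi> S)"
  using assms
proof (induction S rule: finite_induct)
  case empty
  then show ?case using real_character_principal[of M] by (simp add: product_character_def)
next
  case (insert p S)
  then have "real_character M (\<lambda>n. \<phi> p n * product_character M \<phi> S n)"
    by (intro real_character_mult) auto
  moreover have "product_character M \<phi> (insert p S) = (\<lambda>n. \<phi> p n * product_character M \<phi> S n)"
    using insert.hyps by (auto simp: product_character_def fun_eq_iff)
  ultimately show ?case by simp
qed

text \<open>The terms are nonnegative, so it suffices to keep n = (j M + 1)^2 for j < J, which are
  coprime to \<open>M\<close>. Each contributes at least 1 / (j M + 1) >= 1 / ((j + 1) M), and the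
  harmonic sum exceeds any bound.\<close>

lemma divisor_sum_unbounded:
  assumes f: "real_character M f" and M: "M > 0"
  shows "\<exists>y. (\<Sum>n\<in>{0<..y * y}. principal_character M n * (\<Sum>d | d dvd n. f d) / sqrt n) > B"
proof -
  \<comment> \<open>\<open>J\<close> is chosen so that ln J >= M (\<bar>B\<bar> + 1), and
    \<open>y\<close> so that all \<open>J\<close> squares lie below \<open>y * y\<close>.\<close>
  define J where "J = nat \<lceil>exp (M * (\<bar>B\<bar> + 1))\<rceil>"
  define y where "y = Suc (J * M)"
  define r where "r n = (\<Sum>d | d dvd n. f d)" for n
  define t where "t n = principal_character M n * r n / sqrt n" for n
  have nonneg: "t n \<ge> 0" if "n > 0" for n
    using divisor_sum_support[OF f that, folded r_def] by (auto simp: t_def principal_character_def)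
  have cop: "coprime (j * M + 1) M" for j
    unfolding coprime_iff_gcd_eq_1 using gcd_add_mult[of M j 1] by (simp add: gcd.commute)
  define h where "h j = (j * M + 1)\<^sup>2" for j
  have inj: "inj_on h {..<J}" using M by (auto simp: inj_on_def h_def)
  have "h j \<le> y\<^sup>2" if "j < J" for j
    unfolding h_def y_def using that by (intro power_mono) auto
  then have sub: "h ` {..<J} \<subseteq> {0<..y * y}"
    by (auto simp: h_def power2_eq_square)
  have "B < \<bar>B\<bar> + 1" by linarith
  also have "\<dots> \<le> ln (real (Suc J)) / M"
  proof -
    have "exp (M * (\<bar>B\<bar> + 1)) \<le> real J" unfolding J_def by linarith
    then have "exp (M * (\<bar>B\<bar> + 1)) \<le> real (Suc J)" by simp
    then have "M * (\<bar>B\<bar> + 1) \<le> ln (real (Suc J))" by (subst ln_ge_iff) auto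
    then show ?thesis using M by (simp add: field_simps)
  qed
  also have "\<dots> \<le> (\<Sum>j<J. 1 / real (Suc j)) / M"
    using ln_le_harmonic_sum[of J] by (intro divide_right_mono) auto
  also have "\<dots> = (\<Sum>j<J. 1 / (real (Suc j) * M))" by (simp add: sum_divide_distrib)
  also have "\<dots> \<le> (\<Sum>j<J. t (h j))"
  proof (rule sum_mono)
    fix j
    have "real (j * M + 1) \<le> real (Suc j) * M" using M by (simp add: algebra_simps)
    then have "1 / (real (Suc j) * M) \<le> 1 / real (j * M + 1)"
      using M by (intro frac_le) (auto simp: add_pos_nonneg)
    also have "\<dots> = 1 / sqrt (h j)" by (simp add: h_def)
    also have "\<dots> \<le> t (h j)"
    proof -
      have "r (h j) \<ge> 1"
        unfolding h_def r_def by (rule divisor_sum_square_ge_1[OF f _ cop]) simp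
      moreover have "coprime (h j) M" unfolding h_def coprime_power_left_iff using cop by blast
      ultimately show ?thesis unfolding t_def principal_character_def
        by (intro divide_right_mono) auto
    qed
    finally show "1 / (real (Suc j) * M) \<le> t (h j)" .
  qed
  also have "\<dots> = sum t (h ` {..<J})" by (simp add: sum.reindex[OF inj] o_def)
  also have "\<dots> \<le> sum t {0<..y * y}" using nonneg sub by (intro sum_mono2) auto
  finally show ?thesis unfolding t_def r_def by blast
qed

section \<open>Twisted divisor sums and prescribed signs\<close>

text \<open>Since g d g (n/d) = g n, twisting the divisor sum by \<open>g\<close> produces the
  Dirichlet convolution of f g with \<open>g\<close>. The hyperbola bound applies once both of these
  are nonprincipal.\<close>

lemma twisted_divisor_sum:
  assumes f: "real_character M f" and g: "real_character M g" and "n > 0"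
  shows "(\<Sum>d | d dvd n. f d * g d * g (n div d)) = g n * (\<Sum>d | d dvd n. f d)"
proof -
  have "f d * g d * g (n div d) = g n * f d" if "d dvd n" for d
    using real_characterD(1)[OF g, of d "n div d"] that by simp
  then show ?thesis unfolding sum_distrib_left by (intro sum.cong) auto
qed

text \<open>When f g is principal, \<open>f\<close> and \<open>g\<close> agree on arguments coprime
  to \<open>M\<close>; the convolution is then the original divisor sum, which is
  nonnegative.\<close>

lemma twisted_divisor_sum_nonneg:
  assumes f: "real_character M f" and g: "real_character M g" and "n > 0"
    and fg: "\<And>n. f n * g n = principal_character M n"
  shows "g n * (\<Sum>d | d dvd n. f d) \<ge> 0"
proof (cases "coprime n M")
  case True
  have "g (n div d) = f (n div d)" and "principal_character M d = 1" if "d dvd n" for d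
  proof -
    have c: "coprime (n div d) M" "coprime d M" using True that
      by (metis coprime_mult_left_iff dvd_mult_div_cancel)+
    show "g (n div d) = f (n div d)"
      using fg[of "n div d"] c real_characterD(3)[OF f c(1)] real_characterD(3)[OF g c(1)]
      by (auto simp: principal_character_def)
    show "principal_character M d = 1" using c by (simp add: principal_character_def)
  qed
  then have "(\<Sum>d | d dvd n. f d * g d * g (n div d)) = (\<Sum>d | d dvd n. f (n div d))"
    by (intro sum.cong) (auto simp: fg)
  also have "\<dots> = (\<Sum>d | d dvd n. f d)"
    by (rule sum.reindex_bij_witness[of _ "\<lambda>d. n div d" "\<lambda>d. n div d"]) (use \<open>n > 0\<close> in auto)
  finally have eq: "(\<Sum>d | d dvd n. f d * g d * g (n div d)) = (\<Sum>d | d dvd n. f d)" .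
  have "g n * (\<Sum>d | d dvd n. f d) = (\<Sum>d | d dvd n. f d)"
    by (rule trans[OF twisted_divisor_sum[OF f g \<open>n > 0\<close>, symmetric] eq])
  then show ?thesis
    using divisor_sum_support[OF f \<open>n > 0\<close> True] by (simp only:)
next
  case False
  then show ?thesis using real_characterD(4)[OF g] by simp
qed

text \<open>If no such \<open>n\<close> existed, every term of the weighted series would vanish:
  either its divisor sum is 0 or some factor 1 + \<epsilon> p \<phi> p n is. Expanding the products
  over subsets \<open>S\<close> shows that finitely many sums add up to 0 for every
  \<open>y\<close>, although the one for \<open>S = {}\<close> is unbounded above and the others are
  bounded below. The second alternative in \<open>twist\<close> covers a principal f g, where the
  hyperbola bound fails but the sum, taken with sign +1, is nonnegative.\<close>

lemma exists_divisor_sum_with_signs: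
  fixes \<phi> :: "'a \<Rightarrow> nat \<Rightarrow> int" and \<epsilon> :: "'a \<Rightarrow> int"
  assumes M: "M > 0" and f: "real_character M f" and P: "finite P"
    and \<phi>: "\<And>p. p \<in> P \<Longrightarrow> real_character M (\<phi> p)"
    and \<epsilon>: "\<And>p. p \<in> P \<Longrightarrow> \<epsilon> p = 1 \<or> \<epsilon> p = -1"
    and nonprincipal: "\<And>S. S \<subseteq> P \<Longrightarrow> S \<noteq> {} \<Longrightarrow> \<exists>b. product_character M \<phi> S b = -1"
    and twist: "\<And>S. S \<subseteq> P \<Longrightarrow> S \<noteq> {} \<Longrightarrow>
      (\<exists>b. f b * product_character M \<phi> S b = -1) \<or>
      (\<forall>n. f n * product_character M \<phi> S n = principal_character M n) \<and> (\<Prod>p\<in>S. \<epsilon> p) = 1"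
  shows "\<exists>n>0. coprime n M \<and> (\<Sum>d | d dvd n. f d) \<noteq> 0 \<and> (\<forall>p\<in>P. \<phi> p n = \<epsilon> p)"
proof (rule ccontr)
  assume contra: "\<not> ?thesis"
  define K where "K = 4 * real M ^ 2 + 8 * real M"
  define r where "r n = (\<Sum>d | d dvd n. f d)" for n
  define g where "g S = product_character M \<phi> S" for S
  define T where "T S y = (\<Sum>n\<in>{0<..y * y}. g S n * r n / sqrt n)" for S y
  have gS: "real_character M (g S)" if "S \<subseteq> P" for S
    unfolding g_def using that P \<phi> by (intro real_character_product) (auto intro: finite_subset)
  have K: "K \<ge> 0" by (simp add: K_def)
  have T_ge: "(\<Prod>p\<in>S. \<epsilon> p) * T S y \<ge> - K" if S: "S \<subseteq> P" "S \<noteq> {}" for S y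
    using twist[OF S]
  proof
    assume "\<exists>b. f b * product_character M \<phi> S b = -1"
    then obtain b where b: "f b * g S b = -1" by (auto simp: g_def)
    obtain c where c: "g S c = -1" using nonprincipal[OF S] by (auto simp: g_def)
    \<comment> \<open>The twisted sum is rewritten as a sum of a convolution, the shape required by
      the hyperbola bound.\<close>
    have "T S y = (\<Sum>n\<in>{0<..y * y}. \<Sum>d | d dvd n.
        (f d * g S d) * g S (n div d) / sqrt (d * (n div d)))"
      unfolding T_def
    proof (rule sum.cong[OF refl])
      fix n assume n: "n \<in> {0<..y * y}"
      have "g S n * r n = (\<Sum>d | d dvd n. f d * g S d * g S (n div d))"
        unfolding r_def using twisted_divisor_sum[OF f gS[OF S(1)]] n by simp
      then have "g S n * r n / sqrt n
          = (\<Sum>d | d dvd n. real_of_int (f d * g S d * g S (n div d)) / sqrt n)"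
        by (metis of_int_mult of_int_sum sum_divide_distrib)
      also have "\<dots> = (\<Sum>d | d dvd n. (f d * g S d) * g S (n div d) / sqrt (d * (n div d)))"
        by (intro sum.cong) (auto simp flip: of_nat_mult)
      finally show "g S n * r n / sqrt n = \<dots>" .
    qed
    also have "\<dots> = (\<Sum>(a, b)\<in>hyperbola (y * y). (f a * g S a) * g S b / sqrt (a * b))"
      by (rule sum_hyperbola_by_product[symmetric])
    finally have "\<bar>T S y\<bar> \<le> K"
      unfolding K_def
      using hyperbola_character_sum_bound[OF real_character_mult[OF f gS[OF S(1)]] b gS[OF S(1)] c M, of y]
      by simp
    moreover have "\<bar>\<epsilon> p\<bar> = 1" if "p \<in> S" for p
    proof -
      have "p \<in> P" using that S(1) by blast
      then show ?thesis using \<epsilon>[of p] by auto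
    qed
    then have "\<bar>\<Prod>p\<in>S. \<epsilon> p\<bar> = 1" unfolding abs_prod by (intro prod.neutral) auto
    then have "\<bar>(\<Prod>p\<in>S. \<epsilon> p) * T S y\<bar> = \<bar>T S y\<bar>"
      by (metis abs_mult mult_1 of_int_1 of_int_abs)
    ultimately show ?thesis by linarith
  next
    assume tw: "(\<forall>n. f n * product_character M \<phi> S n = principal_character M n) \<and> (\<Prod>p\<in>S. \<epsilon> p) = 1"
    have "g S n * r n \<ge> 0" if "n > 0" for n
      unfolding r_def using tw by (intro twisted_divisor_sum_nonneg[OF f gS[OF S(1)] that]) (auto simp: g_def)
    then have "T S y \<ge> 0" unfolding T_def
      by (intro sum_nonneg divide_nonneg_nonneg) (auto simp flip: of_int_mult)
    then show ?thesis using tw K by simp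
  qed
  have zero: "principal_character M n * r n * (\<Prod>p\<in>P. \<epsilon> p * \<phi> p n + 1) = 0" if "n > 0" for n
  proof (cases "coprime n M \<and> r n \<noteq> 0")
    case True
    then obtain p where p: "p \<in> P" "\<phi> p n \<noteq> \<epsilon> p" using contra that by (auto simp: r_def)
    then have "\<epsilon> p * \<phi> p n + 1 = 0" using \<epsilon>[OF p(1)] real_characterD(3)[OF \<phi>[OF p(1)], of n] True by auto
    then show ?thesis using p(1) P by (auto intro: prod_zero)
  next
    case False
    then show ?thesis by (auto simp: principal_character_def)
  qed
  \<comment> \<open>The subset \<open>S\<close> records the primes whose term \<epsilon> p \<phi> p
    n, rather than 1, is taken from the factor.\<close>
  have expand: "principal_character M n * r n * (\<Prod>p\<in>P. \<epsilon> p * \<phi> p n + 1) =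
      (\<Sum>S\<in>Pow P. (\<Prod>p\<in>S. \<epsilon> p) * (g S n * r n))" for n
    unfolding prod_add[OF P]
    by (simp add: sum_distrib_left g_def product_character_def prod.distrib mult_ac)
  have total: "(\<Sum>S\<in>Pow P. (\<Prod>p\<in>S. \<epsilon> p) * T S y) = 0" for y
  proof -
    have "(\<Sum>S\<in>Pow P. (\<Prod>p\<in>S. \<epsilon> p) * T S y)
        = (\<Sum>n\<in>{0<..y * y}. \<Sum>S\<in>Pow P. (\<Prod>p\<in>S. \<epsilon> p) * (g S n * r n / sqrt n))"
      unfolding T_def sum_distrib_left by (rule sum.swap)
    also have "\<dots> = (\<Sum>n\<in>{0<..y * y}. real_of_int (\<Sum>S\<in>Pow P. (\<Prod>p\<in>S. \<epsilon> p) * (g S n * r n)) / sqrt n)"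
      by (simp add: sum_divide_distrib)
    also have "\<dots> = 0" by (intro sum.neutral) (auto simp: zero simp flip: expand)
    finally show ?thesis .
  qed
  obtain y where y: "T {} y > card (Pow P) * K"
    using divisor_sum_unbounded[OF f M, of "card (Pow P) * K"]
    unfolding T_def g_def r_def product_character_def by auto
  have "0 = T {} y + (\<Sum>S\<in>Pow P - {{}}. (\<Prod>p\<in>S. \<epsilon> p) * T S y)"
    using total[of y] P by (subst (asm) sum.remove[of _ "{}"]) auto
  also have "\<dots> \<ge> T {} y + (\<Sum>S\<in>Pow P - {{}}. - K)"
    using T_ge by (intro add_left_mono sum_mono) auto
  finally have "T {} y \<le> card (Pow P - {{}}) * K" by simp
  also have "\<dots> \<le> card (Pow P) * K"
    using P K by (intro mult_right_mono) (auto intro!: card_mono)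
  finally show False using y by simp
qed

section \<open>Legendre symbols as characters\<close>

text \<open>Two values in {-1, 0, 1} differ by at most 2 < p. This turns the congruences of Euler's
  criterion into equalities.\<close>

lemma eq_if_cong_mod_prime:
  fixes x y :: int and p :: nat
  assumes "[x = y] (mod int p)" "p > 2" "\<bar>x\<bar> \<le> 1" "\<bar>y\<bar> \<le> 1"
  shows "x = y"
proof (rule ccontr)
  assume "x \<noteq> y"
  moreover have "int p dvd x - y" using assms(1) by (simp add: cong_iff_dvd_diff)
  ultimately have "\<bar>int p\<bar> \<le> \<bar>x - y\<bar>" by (intro dvd_imp_le_int) auto
  then show False using assms(2-4) by linarith
qed

lemma Legendre_abs_le: "\<bar>Legendre a p\<bar> \<le> 1"
  by (simp add: Legendre_def)

lemma Legendre_cong: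
  assumes "[a = b] (mod p)"
  shows "Legendre a p = Legendre b p"
proof -
  have "[x = a] (mod p) \<longleftrightarrow> [x = b] (mod p)" for x
    using assms by (simp add: cong_def)
  moreover have "[a = 0] (mod p) \<longleftrightarrow> [b = 0] (mod p)"
    using assms by (simp add: cong_def)
  ultimately show ?thesis unfolding Legendre_def QuadRes_def by simp
qed

lemma Legendre_sign:
  assumes "\<not> int p dvd a"
  shows "Legendre a (int p) = 1 \<or> Legendre a (int p) = -1"
  using assms by (simp add: Legendre_def cong_0_iff)

lemma Legendre_eq_1_imp_QuadRes: "Legendre a p = 1 \<Longrightarrow> QuadRes p a"
  unfolding Legendre_def by (auto split: if_splits)

lemma Legendre_mult:
  assumes "prime p" "p > 2"
  shows "Legendre (a * b) (int p) = Legendre a (int p) * Legendre b (int p)"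
proof (rule eq_if_cong_mod_prime)
  let ?k = "(p - 1) div 2"
  have "[Legendre (a * b) p = (a * b) ^ ?k] (mod p)" by (rule euler_criterion[OF assms])
  also have "(a * b) ^ ?k = a ^ ?k * b ^ ?k" by (rule power_mult_distrib)
  also have "[\<dots> = Legendre a p * Legendre b p] (mod p)"
    by (intro cong_mult cong_sym[OF euler_criterion[OF assms]])
  finally show "[Legendre (a * b) p = Legendre a p * Legendre b p] (mod p)" .
  show "\<bar>Legendre a (int p) * Legendre b (int p)\<bar> \<le> 1"
    unfolding abs_mult using Legendre_abs_le[of a p] Legendre_abs_le[of b p]
      mult_mono[of "\<bar>Legendre a p\<bar>" 1 "\<bar>Legendre b p\<bar>" 1] by simp
qed (use assms Legendre_abs_le in auto)

lemma Legendre_one: "prime p \<Longrightarrow> Legendre 1 (int p) = 1"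
  by (auto simp: Legendre_def QuadRes_def cong_0_iff intro: exI[of _ 1])

section \<open>The characters modulo 4 and 8 and the supplements to reciprocity\<close>

text \<open>The symbol (-1/n) for odd \<open>n\<close>.\<close>

definition chi4 :: "nat \<Rightarrow> int" where
  "chi4 n = (if n mod 4 = 1 then 1 else if n mod 4 = 3 then -1 else 0)"

text \<open>The symbol (2/n) for odd \<open>n\<close>.\<close>

definition chi8 :: "nat \<Rightarrow> int" where
  "chi8 n = (if n mod 8 \<in> {1, 7} then 1 else if n mod 8 \<in> {3, 5} then -1 else 0)"

lemma chi4_mult: "chi4 (m * n) = chi4 m * chi4 n"
proof -
  have "m mod 4 < 4" "n mod 4 < 4" by auto
  then have "m mod 4 \<in> {0, 1, 2, 3}" "n mod 4 \<in> {0, 1, 2, 3}" by auto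
  moreover have "(m * n) mod 4 = ((m mod 4) * (n mod 4)) mod 4" by (simp add: mod_mult_eq)
  ultimately show ?thesis unfolding chi4_def by auto
qed

lemma chi8_even: "even n \<Longrightarrow> chi8 n = 0"
  unfolding chi8_def by simp presburger

lemma chi8_mult: "chi8 (m * n) = chi8 m * chi8 n"
proof (cases "even m \<or> even n")
  case True
  then show ?thesis by (auto simp: chi8_even)
next
  case False
  then have "odd m" "odd n" by auto
  then have "m mod 8 = 1 \<or> m mod 8 = 3 \<or> m mod 8 = 5 \<or> m mod 8 = 7"
    "n mod 8 = 1 \<or> n mod 8 = 3 \<or> n mod 8 = 5 \<or> n mod 8 = 7" by presburger+
  moreover have "(m * n) mod 8 = ((m mod 8) * (n mod 8)) mod 8" by (simp add: mod_mult_eq)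
  ultimately show ?thesis unfolding chi8_def by (elim disjE) simp_all
qed

lemma chi4_mod_8: "chi4 (n mod 8) = chi4 n"
  by (simp add: chi4_def mod_mod_cancel)

lemma chi8_mod_8: "chi8 (n mod 8) = chi8 n"
  by (simp add: chi8_def)

lemma chi4_odd: "odd n \<Longrightarrow> chi4 n = 1 \<or> chi4 n = -1"
  unfolding chi4_def by presburger

lemma chi8_odd: "odd n \<Longrightarrow> chi8 n = 1 \<or> chi8 n = -1"
  unfolding chi8_def by simp presburger

lemma Legendre_minus_one:
  assumes "prime p" "p > 2"
  shows "Legendre (-1) (int p) = chi4 p"
proof (rule eq_if_cong_mod_prime)
  have "odd p" using assms prime_odd_nat by simp
  then have "(-1 :: int) ^ ((p - 1) div 2) = chi4 p"
    unfolding chi4_def by (cases "even ((p - 1) div 2)") (simp_all, presburger+)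
  then show "[Legendre (-1) p = chi4 p] (mod p)" using euler_criterion[OF assms, of "-1"] by simp
qed (use assms Legendre_abs_le in \<open>auto simp: chi4_def\<close>)

lemma Legendre_two:
  assumes "prime p" "p > 2"
  shows "Legendre 2 (int p) = chi8 p"
proof -
  have "odd p" using assms prime_odd_nat by simp
  have "\<not> int p dvd 2" using assms(2) zdvd_not_zless by simp
  then interpret GAUSS p 2 using assms by unfold_locales (auto simp: cong_0_iff)
  \<comment> \<open>For the multiplier 2 the products 2 x with x <= (p-1)/2 are already reduced
    modulo \<open>p\<close>, so Gauss's lemma counts the x with 2 x > (p-1)/2.\<close>
  have "E = (\<lambda>x. 2 * x) ` {(int p - 1) div 4 <.. (int p - 1) div 2}" (is "_ = ?R")
  proof -
    have "C = (\<lambda>x. 2 * x) ` A"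
      unfolding C_def B_def image_image
    proof (rule image_cong[OF refl])
      fix x assume "x \<in> A"
      then have "0 < x" "x \<le> (int p - 1) div 2" by (auto simp: A_def)
      then have "0 \<le> x * 2" "x * 2 < int p" by linarith+
      then show "x * 2 mod int p = 2 * x" by simp
    qed
    then show ?thesis unfolding E_def A_def using assms(2) by (auto simp: image_iff)
  qed
  moreover have "card ?R = nat ((int p - 1) div 2 - (int p - 1) div 4)"
    by (subst card_image) (auto simp: inj_on_def)
  ultimately have "card E = (p - 1) div 2 - (p - 1) div 4" using assms(2) by (simp add: nat_diff_distrib' nat_div_distrib')
  moreover have "(-1 :: int) ^ ((p - 1) div 2 - (p - 1) div 4) = chi8 p"
  proof -
    define k where "k = p div 8"
    have "p mod 8 = 1 \<or> p mod 8 = 3 \<or> p mod 8 = 5 \<or> p mod 8 = 7" using \<open>odd p\<close> by presburger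
    moreover have "p = 8 * k + p mod 8" by (simp add: k_def)
    ultimately have "p = 8 * k + 1 \<or> p = 8 * k + 3 \<or> p = 8 * k + 5 \<or> p = 8 * k + 7" by auto
    then show ?thesis
    proof (elim disjE)
      assume p: "p = 8 * k + 1"
      have "(p - 1) div 2 - (p - 1) div 4 = 2 * k" using p by simp
      then show ?thesis using p by (simp add: chi8_def)
    next
      assume p: "p = 8 * k + 3"
      have "(p - 1) div 2 - (p - 1) div 4 = 2 * k + 1" using p by simp
      then show ?thesis using p by (simp add: chi8_def)
    next
      assume p: "p = 8 * k + 5"
      have "(p - 1) div 2 - (p - 1) div 4 = 2 * k + 1" using p by simp
      then show ?thesis using p by (simp add: chi8_def)
    next
      assume p: "p = 8 * k + 7"
      have "(p - 1) div 2 - (p - 1) div 4 = 2 * (k + 1)" using p by simp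
      then show ?thesis using p by (simp add: chi8_def)
    qed
  qed
  ultimately show ?thesis using gauss_lemma by simp
qed

section \<open>Products of odd primes and the common modulus\<close>

definition odd_primes :: "nat set \<Rightarrow> bool" where
  "odd_primes P \<longleftrightarrow> finite P \<and> (\<forall>p\<in>P. prime p \<and> p > 2)"

lemma odd_primesD: "odd_primes P \<Longrightarrow> finite P" "odd_primes P \<Longrightarrow> p \<in> P \<Longrightarrow> prime p"
  "odd_primes P \<Longrightarrow> p \<in> P \<Longrightarrow> p > 2" "odd_primes P \<Longrightarrow> p \<in> P \<Longrightarrow> odd p"
  unfolding odd_primes_def using prime_odd_nat by auto

lemma odd_primes_prod_odd: "odd_primes P \<Longrightarrow> odd (\<Prod>P)"
  using odd_primesD(1,4) by (auto simp: even_prod_iff)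

text \<open>Jacobi's form of reciprocity for a product of distinct odd primes, by multiplying the
  laws for the single primes.\<close>

lemma Legendre_prod_reciprocity:
  assumes "odd_primes P" and q: "prime q" "q > 2" "q \<notin> P"
  shows "Legendre (int (\<Prod>P)) (int q) =
    (if (\<Prod>P) mod 4 = 3 \<and> q mod 4 = 3 then -1 else 1) * (\<Prod>p\<in>P. Legendre (int q) (int p))"
proof -
  have "finite P" using assms(1) odd_primesD(1) by blast
  then show ?thesis using assms(1,4)
  proof (induction P rule: finite_induct)
    case empty
    then show ?case using Legendre_one[OF q(1)] by simp
  next
    case (insert p P)
    have P: "odd_primes P" and p: "prime p" "p > 2" "p \<noteq> q" "q \<notin> P"
      using insert.prems by (auto simp: odd_primes_def)
    have "odd p" using p prime_odd_nat by simp
    have "\<not> p dvd q" using p q(1) primes_dvd_imp_eq by blast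
    then have nd: "\<not> int p dvd int q" by simp
    have "odd q" using q prime_odd_nat by simp
    have sq: "Legendre q p * Legendre q p = 1" using Legendre_sign[OF nd] by auto
    have "Legendre p q * Legendre q p = (-1) ^ ((p - 1) div 2 * ((q - 1) div 2))"
      using Quadratic_Reciprocity p q by simp
    also have "\<dots> = (if p mod 4 = 3 \<and> q mod 4 = 3 then -1 else 1)"
    proof -
      have "even ((p - 1) div 2) \<longleftrightarrow> p mod 4 \<noteq> 3" "even ((q - 1) div 2) \<longleftrightarrow> q mod 4 \<noteq> 3"
        using \<open>odd p\<close> \<open>odd q\<close> by presburger+
      then show ?thesis by (simp add: uminus_power_if)
    qed
    finally have "Legendre p q * (Legendre q p * Legendre q p)
        = (if p mod 4 = 3 \<and> q mod 4 = 3 then -1 else 1) * Legendre q p"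
      by (simp add: mult.assoc)
    then have pq: "Legendre p q = (if p mod 4 = 3 \<and> q mod 4 = 3 then -1 else 1) * Legendre q p"
      by (simp add: sq)
    have "odd (\<Prod>P)" by (rule odd_primes_prod_odd[OF P])
    \<comment> \<open>A product of odd numbers is 3 modulo 4 exactly when an odd number of its
      factors are, so the signs combine in the same way.\<close>
    have m: "(p * \<Prod>P) mod 4 = 3 \<longleftrightarrow> (p mod 4 = 3) \<noteq> ((\<Prod>P) mod 4 = 3)"
    proof -
      have "p mod 4 = 1 \<or> p mod 4 = 3" "(\<Prod>P) mod 4 = 1 \<or> (\<Prod>P) mod 4 = 3"
        using \<open>odd p\<close> \<open>odd (\<Prod>P)\<close> by presburger+
      moreover have "(p * \<Prod>P) mod 4 = ((p mod 4) * ((\<Prod>P) mod 4)) mod 4" by (simp add: mod_mult_eq)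
      ultimately show ?thesis by auto
    qed
    have "Legendre (int (\<Prod>(insert p P))) q = Legendre (int p * int (\<Prod>P)) q"
      using insert.hyps by simp
    also have "\<dots> = Legendre p q * Legendre (int (\<Prod>P)) q" by (rule Legendre_mult[OF q(1,2)])
    also have "\<dots> = (if p mod 4 = 3 \<and> q mod 4 = 3 then -1 else 1) * Legendre q p *
       ((if (\<Prod>P) mod 4 = 3 \<and> q mod 4 = 3 then -1 else 1) * (\<Prod>p\<in>P. Legendre q p))"
      using insert.IH[OF P p(4)] pq by simp
    also have "\<dots> = (if (\<Prod>(insert p P)) mod 4 = 3 \<and> q mod 4 = 3 then -1 else 1) * (\<Prod>p\<in>insert p P. Legendre q p)"
      using insert.hyps m by auto
    finally show ?case .
  qed
qed

text \<open>If every unit were a square, squaring would be onto, hence injective, on the residues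
  modulo \<open>p\<close>; but 1 and p - 1 have the same square.\<close>

lemma exists_nonresidue:
  assumes "prime p" "p > 2"
  shows "\<exists>u::nat. Legendre (int u) (int p) = -1"
proof (rule ccontr)
  assume no: "\<not> ?thesis"
  have "(\<lambda>y. y\<^sup>2 mod p) ` {..<p} = {..<p}"
  proof (intro equalityI subsetI)
    fix u assume u: "u \<in> {..<p}"
    have "\<exists>y. [y\<^sup>2 = int u] (mod int p)"
    proof (cases "u = 0")
      case True
      then show ?thesis by (intro exI[of _ 0]) simp
    next
      case False
      then have "\<not> int p dvd int u" using u nat_dvd_not_less by simp
      then have "Legendre (int u) (int p) = 1" using no Legendre_sign by blast
      then show ?thesis using Legendre_eq_1_imp_QuadRes QuadRes_def by blast
    qed
    then obtain y where y: "[y\<^sup>2 = int u] (mod int p)" by blast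
    define z where "z = nat (y mod int p)"
    have z: "int z = y mod int p" using assms(2) by (simp add: z_def)
    have "int (z\<^sup>2 mod p) = int u mod int p" using y unfolding cong_def
      by (simp add: zmod_int z power_mod)
    then have "z\<^sup>2 mod p = u" using u by simp
    moreover have "z < p" using z assms(2) pos_mod_bound[of "int p" y] by linarith
    ultimately show "u \<in> (\<lambda>y. y\<^sup>2 mod p) ` {..<p}" by auto
  qed (use assms(2) in auto)
  then have "inj_on (\<lambda>y. y\<^sup>2 mod p) {..<p}" by (intro eq_card_imp_inj_on) auto
  moreover have "(p - 1)\<^sup>2 mod p = 1\<^sup>2 mod p"
  proof -
    obtain k where "p = 2 + k" using assms(2) le_Suc_ex[of 2 p] by auto
    then have "(p - 1)\<^sup>2 = 1 + p * k" by (simp add: power2_eq_square)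
    then show ?thesis by (simp only: mod_mult_self2 one_power2)
  qed
  ultimately have "p - 1 = 1" using assms(2) by (auto dest!: inj_onD[where x = "p - 1" and y = 1])
  then show False using assms(2) by simp
qed

lemma coprime_8_prod_iff:
  assumes "odd_primes P"
  shows "coprime n (8 * \<Prod>P) \<longleftrightarrow> odd n \<and> (\<forall>p\<in>P. \<not> p dvd n)"
proof -
  have "coprime n 8 \<longleftrightarrow> odd n"
    using coprime_power_right_iff[of n 2 3] by (simp add: coprime_right_2_iff_odd)
  moreover have "coprime n (\<Prod>P) \<longleftrightarrow> (\<forall>p\<in>P. \<not> p dvd n)"
  proof
    assume c: "coprime n (\<Prod>P)"
    show "\<forall>p\<in>P. \<not> p dvd n"
    proof
      fix p assume p: "p \<in> P"
      then have "p dvd \<Prod>P" using dvd_prodI[of P p "\<lambda>x. x"] odd_primesD(1)[OF assms] by simp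
      then show "\<not> p dvd n" using c odd_primesD(2)[OF assms p]
        by (metis coprime_common_divisor not_prime_unit)
    qed
  next
    assume "\<forall>p\<in>P. \<not> p dvd n"
    then show "coprime n (\<Prod>P)" using odd_primesD(2)[OF assms]
      by (intro prod_coprime_right) (metis coprime_commute prime_imp_coprime)
  qed
  ultimately show ?thesis by simp
qed

text \<open>Lifts a character of smaller modulus to modulus \<open>M\<close> by setting it to 0 off
  the units, so that all characters in play share the modulus \<open>8 * \<Prod>P\<close>.\<close>

definition restricted :: "nat \<Rightarrow> (nat \<Rightarrow> int) \<Rightarrow> nat \<Rightarrow> int" where
  "restricted M f n = principal_character M n * f n"

lemma real_character_restricted:
  assumes "\<And>m n. f (m * n) = f m * f n" "\<And>n. f (n + M) = f n"
    and "\<And>n. coprime n M \<Longrightarrow> f n = 1 \<or> f n = -1"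
  shows "real_character M (restricted M f)"
  using real_character_principal[of M] assms
  unfolding real_character_def restricted_def by (auto simp: principal_character_def)

lemma real_character_Legendre:
  assumes "odd_primes P" "p \<in> P"
  shows "real_character (8 * \<Prod>P) (restricted (8 * \<Prod>P) (\<lambda>n. Legendre (int n) (int p)))"
proof (rule real_character_restricted)
  have p: "prime p" "p > 2" using odd_primesD[OF assms(1)] assms(2) by auto
  show "Legendre (int (m * n)) (int p) = Legendre (int m) (int p) * Legendre (int n) (int p)" for m n
    using Legendre_mult[OF p] by simp
  have "p dvd \<Prod>P" using dvd_prodI[of P p "\<lambda>x. x"] odd_primesD(1)[OF assms(1)] assms(2) by simp
  then have "p dvd 8 * \<Prod>P" by (rule dvd_mult)
  then obtain k where k: "8 * \<Prod>P = p * k" by (rule dvdE)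
  have "[n + 8 * \<Prod>P = n] (mod p)" for n unfolding k cong_def by simp
  then have "[int (n + 8 * \<Prod>P) = int n] (mod int p)" for n using cong_int_iff by blast
  then show "Legendre (int (n + 8 * \<Prod>P)) (int p) = Legendre (int n) (int p)" for n
    by (rule Legendre_cong)
  show "Legendre (int n) (int p) = 1 \<or> Legendre (int n) (int p) = -1" if "coprime n (8 * \<Prod>P)" for n
    using that coprime_8_prod_iff[OF assms(1)] assms(2) by (intro Legendre_sign) auto
qed

section \<open>Sums of three squares: the squarefree case\<close>

text \<open>For the appropriate \<psi> its value at a prime q coprime to the modulus is (-N/q).
  Writing it through the inverted symbols (n/p) makes it visibly a character modulo
  \<open>8 * \<Prod>P\<close>.\<close>

definition quadratic_character :: "nat set \<Rightarrow> (nat \<Rightarrow> int) \<Rightarrow> nat \<Rightarrow> int" where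
  "quadratic_character P \<psi> n = restricted (8 * \<Prod>P) \<psi> n *
     product_character (8 * \<Prod>P) (\<lambda>p. restricted (8 * \<Prod>P) (\<lambda>n. Legendre (int n) (int p))) P n"

lemma Legendre_product_character:
  "coprime n M \<Longrightarrow> product_character M (\<lambda>p. restricted M (\<lambda>n. Legendre (int n) (int p))) S n
     = (\<Prod>p\<in>S. Legendre (int n) (int p))"
  by (simp add: product_character_def restricted_def principal_character_def)

section \<open>Separating the characters by the Chinese remainder theorem\<close>

text \<open>Such a \<open>b\<close> isolates one symbol: the product of the symbols over a set S of
  primes in \<open>P\<close> is -1 at \<open>b\<close> exactly when p is in S.\<close>

lemma exists_single_nonresidue:
  assumes P: "odd_primes P" and p: "p \<in> P"
  shows "\<exists>b. coprime b (8 * \<Prod>P) \<and> b mod 8 = 1 \<and> Legendre (int b) (int p) = -1 \<and>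
    (\<forall>q\<in>P - {p}. Legendre (int b) (int q) = 1)"
proof -
  have pp: "prime p" "p > 2" using odd_primesD[OF P] p by auto
  obtain u where u: "Legendre (int u) (int p) = -1" using exists_nonresidue[OF pp] by blast
  have P': "odd_primes (P - {p})" using P unfolding odd_primes_def by blast
  have "coprime p (8 * \<Prod>(P - {p}))"
    using odd_primesD[OF P] p pp primes_dvd_imp_eq unfolding coprime_8_prod_iff[OF P'] by blast
  then obtain b where b: "[b = u] (mod p)" "[b = 1] (mod (8 * \<Prod>(P - {p})))"
    using binary_chinese_remainder_nat by blast
  have bp: "Legendre (int b) (int p) = -1"
    using b(1) u Legendre_cong by (metis cong_int_iff)
  have bq: "Legendre (int b) (int q) = 1" if q: "q \<in> P - {p}" for q
  proof -
    have "q dvd \<Prod>(P - {p})"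
      using dvd_prodI[of "P - {p}" q "\<lambda>x. x"] odd_primesD(1)[OF P'] q by simp
    then have "[b = 1] (mod q)" using b(2) cong_dvd_modulus_nat dvd_mult by blast
    then have "[int b = 1] (mod int q)" by (metis cong_int_iff of_nat_1)
    then show ?thesis using Legendre_cong Legendre_one odd_primesD(2)[OF P'] q by metis
  qed
  have "[b = 1] (mod 8)" using b(2) cong_dvd_modulus_nat by fastforce
  then have b8: "b mod 8 = 1" by (simp add: cong_def)
  have "\<not> q dvd b" if "q \<in> P" for q
  proof
    assume "q dvd b"
    then have "Legendre (int b) (int q) = 0" by (simp add: Legendre_def cong_0_iff)
    then show False using bp bq that by (cases "q = p") auto
  qed
  moreover have "odd b" using b8 by presburger
  ultimately have "coprime b (8 * \<Prod>P)" unfolding coprime_8_prod_iff[OF P] by blast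
  then show ?thesis using bp bq b8 by blast
qed

text \<open>The counterpart that isolates the part depending on the residue modulo 8.\<close>

lemma exists_residue_mod_8:
  assumes P: "odd_primes P" and "odd c"
  shows "\<exists>b. coprime b (8 * \<Prod>P) \<and> b mod 8 = c mod 8 \<and> (\<forall>q\<in>P. Legendre (int b) (int q) = 1)"
proof -
  have "coprime 8 (\<Prod>P)"
    using odd_primes_prod_odd[OF P] coprime_power_left_iff[of 2 3 "\<Prod>P"]
    by (simp add: coprime_left_2_iff_odd)
  then obtain b where b: "[b = c] (mod 8)" "[b = 1] (mod \<Prod>P)"
    using binary_chinese_remainder_nat by blast
  have bq: "Legendre (int b) (int q) = 1" if q: "q \<in> P" for q
  proof -
    have "q dvd \<Prod>P"
      using dvd_prodI[of P q "\<lambda>x. x"] odd_primesD(1)[OF P] q by simp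
    then have "[b = 1] (mod q)" using b(2) cong_dvd_modulus_nat by blast
    then have "[int b = 1] (mod int q)" by (metis cong_int_iff of_nat_1)
    then show ?thesis using Legendre_cong Legendre_one odd_primesD(2)[OF P] q by metis
  qed
  have b8: "b mod 8 = c mod 8" using b(1) by (simp add: cong_def)
  have "\<not> q dvd b" if "q \<in> P" for q
    using bq[OF that] by (auto simp: Legendre_def cong_0_iff split: if_splits)
  moreover have "odd b" using b8 \<open>odd c\<close> by presburger
  ultimately have "coprime b (8 * \<Prod>P)" unfolding coprime_8_prod_iff[OF P] by blast
  then show ?thesis using bq b8 by blast
qed

text \<open>The sign lemma is applied to the symbols (n/p), and \<open>a\<close> is the squarefree
  factor of the \<open>n\<close> it provides. For nonempty \<open>S\<close> different from
  \<open>P\<close>, a prime outside \<open>S\<close> gives an argument where f times the product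
  over \<open>S\<close> is -1. For \<open>S = P\<close> only \<psi> survives, whence the dichotomy
  in \<open>nontrivial\<close>.\<close>

lemma exists_split_number:
  fixes \<epsilon> :: "nat \<Rightarrow> int"
  assumes P: "odd_primes P" and \<psi>: "real_character (8 * \<Prod>P) (restricted (8 * \<Prod>P) \<psi>)"
    and \<psi>8: "\<And>n. \<psi> (n mod 8) = \<psi> n" and \<psi>1: "\<psi> 1 = 1"
    and \<epsilon>: "\<And>p. p \<in> P \<Longrightarrow> \<epsilon> p = 1 \<or> \<epsilon> p = -1"
    and nontrivial: "(\<exists>c. odd c \<and> \<psi> c = -1) \<or> (\<forall>c. odd c \<longrightarrow> \<psi> c = 1) \<and> (\<Prod>p\<in>P. \<epsilon> p) = 1"
  shows "\<exists>a. squarefree a \<and> coprime a (8 * \<Prod>P) \<and>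
    (\<forall>q. prime q \<longrightarrow> q dvd a \<longrightarrow> quadratic_character P \<psi> q = 1) \<and>
    (\<forall>p\<in>P. Legendre (int a) (int p) = \<epsilon> p)"
proof -
  define M where "M = 8 * \<Prod>P"
  define \<phi> where "\<phi> p = restricted M (\<lambda>n. Legendre (int n) (int p))" for p
  define f where "f = quadratic_character P \<psi>"
  have M: "M > 0" using odd_primes_prod_odd[OF P] odd_pos by (simp add: M_def)
  have \<phi>: "real_character M (\<phi> p)" if "p \<in> P" for p
    unfolding \<phi>_def M_def using real_character_Legendre[OF P that] .
  have f_eq: "f n = restricted M \<psi> n * product_character M \<phi> P n" for n
    unfolding f_def quadratic_character_def \<phi>_def M_def by simp
  have f: "real_character M f"
    unfolding f_eq[abs_def] using \<psi> \<phi> odd_primesD(1)[OF P]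
    by (intro real_character_mult real_character_product) (auto simp: M_def)
  have gS: "product_character M \<phi> S n = (\<Prod>p\<in>S. Legendre (int n) (int p))" if "coprime n M" for S n
    unfolding \<phi>_def using Legendre_product_character[OF that] .
  have fn: "f n = \<psi> n * (\<Prod>p\<in>P. Legendre (int n) (int p))" if "coprime n M" for n
    using that by (simp add: f_eq gS restricted_def principal_character_def)
  have single: "\<exists>b. coprime b M \<and> \<psi> b = 1 \<and>
      (\<forall>S\<subseteq>P. (\<Prod>q\<in>S. Legendre (int b) (int q)) = (if p \<in> S then -1 else 1))" if p: "p \<in> P" for p
  proof -
    obtain b where b: "coprime b M" "b mod 8 = 1" "Legendre (int b) (int p) = -1"
      "\<forall>q\<in>P - {p}. Legendre (int b) (int q) = 1"
      using exists_single_nonresidue[OF P p] unfolding M_def by blast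
    have "(\<Prod>q\<in>S. Legendre (int b) (int q)) = (if p \<in> S then -1 else 1)" if "S \<subseteq> P" for S
    proof -
      have "finite S" using that odd_primesD(1)[OF P] finite_subset by blast
      moreover have "(\<Prod>q\<in>S. Legendre (int b) (int q)) = (\<Prod>q\<in>S. if q = p then -1 else 1)"
        using b(3,4) that by (intro prod.cong) auto
      ultimately show ?thesis by (simp add: prod.delta)
    qed
    moreover have "\<psi> b = 1" using \<psi>8[of b] b(2) \<psi>1 by simp
    ultimately show ?thesis using b(1) by blast
  qed
  have "\<exists>n>0. coprime n M \<and> (\<Sum>d | d dvd n. f d) \<noteq> 0 \<and> (\<forall>p\<in>P. \<phi> p n = \<epsilon> p)"
  proof (rule exists_divisor_sum_with_signs[OF M f odd_primesD(1)[OF P] \<phi> \<epsilon>])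
    fix S assume S: "S \<subseteq> P" "S \<noteq> {}"
    then obtain p where p: "p \<in> S" "p \<in> P" by blast
    obtain b where "coprime b M"
      and b: "\<forall>S\<subseteq>P. (\<Prod>q\<in>S. Legendre (int b) (int q)) = (if p \<in> S then -1 else 1)"
      using single[OF p(2)] by blast
    moreover have "(\<Prod>q\<in>S. Legendre (int b) (int q)) = -1" using b S(1) p(1) by simp
    ultimately show "\<exists>b. product_character M \<phi> S b = -1" using gS by metis
    show "(\<exists>b. f b * product_character M \<phi> S b = -1) \<or>
      (\<forall>n. f n * product_character M \<phi> S n = principal_character M n) \<and> (\<Prod>p\<in>S. \<epsilon> p) = 1"
    proof (cases "S = P")
      case False
      then obtain p where p: "p \<in> P" "p \<notin> S" using S by blast
      obtain b where "coprime b M" "\<psi> b = 1"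
        and b: "\<forall>S\<subseteq>P. (\<Prod>q\<in>S. Legendre (int b) (int q)) = (if p \<in> S then -1 else 1)"
        using single[OF p(1)] by blast
      moreover have "(\<Prod>q\<in>S. Legendre (int b) (int q)) = 1" using b S(1) p(2) by simp
      moreover have "(\<Prod>q\<in>P. Legendre (int b) (int q)) = -1" using b p(1) by simp
      ultimately have "f b * product_character M \<phi> S b = -1" using gS fn by simp
      then show ?thesis by blast
    next
      case True
      from nontrivial show ?thesis
      proof
        assume "\<exists>c. odd c \<and> \<psi> c = -1"
        then obtain c where c: "odd c" "\<psi> c = -1" by blast
        obtain b where b: "coprime b M" "b mod 8 = c mod 8" "\<forall>q\<in>P. Legendre (int b) (int q) = 1"
          using exists_residue_mod_8[OF P c(1)] unfolding M_def by blast
        have "\<psi> b = -1" using \<psi>8[of b] \<psi>8[of c] b(2) c(2) by simp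
        then have "f b * product_character M \<phi> S b = -1" using b True gS fn by simp
        then show ?thesis by blast
      next
        assume triv: "(\<forall>c. odd c \<longrightarrow> \<psi> c = 1) \<and> (\<Prod>p\<in>P. \<epsilon> p) = 1"
        have "f n * product_character M \<phi> S n = principal_character M n" for n
        proof (cases "coprime n M")
          case cop: True
          then have "odd n" using coprime_8_prod_iff[OF P] M_def by blast
          have "product_character M \<phi> P n = 1 \<or> product_character M \<phi> P n = -1"
            using real_characterD(3)[OF real_character_product cop] \<phi> odd_primesD(1)[OF P] by blast
          then show ?thesis
            using triv \<open>odd n\<close> cop True by (auto simp: f_eq restricted_def principal_character_def)
        next
          case False
          then show ?thesis by (simp add: f_eq restricted_def principal_character_def)
        qed
        then show ?thesis using triv True by blast
      qed
    qed
  qed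
  then obtain n where n: "n > 0" "coprime n M" "(\<Sum>d | d dvd n. f d) \<noteq> 0" "\<forall>p\<in>P. \<phi> p n = \<epsilon> p"
    by blast
  obtain a k where a: "n = a * k\<^sup>2" "squarefree a" "\<forall>q. prime q \<longrightarrow> q dvd a \<longrightarrow> f q = 1"
    using divisor_sum_support[OF f n(1,2)] n(3) by blast
  \<comment> \<open>The square factor \<open>k\<close> is prime to the modulus, so \<open>a\<close>
    has the same symbols as \<open>n\<close>.\<close>
  have cop: "coprime a M" "coprime k M" using n(1,2) a(1) by auto
  have "Legendre (int a) (int p) = \<epsilon> p" if p: "p \<in> P" for p
  proof -
    have pp: "prime p" "p > 2" using odd_primesD[OF P] p by auto
    have k: "\<not> int p dvd int k" using cop(2) p coprime_8_prod_iff[OF P] by (simp add: M_def)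
    have "\<epsilon> p = Legendre (int n) (int p)"
      using n(2,4) p by (simp add: \<phi>_def restricted_def principal_character_def)
    also have "\<dots> = Legendre (int a) (int p) * (Legendre (int k) (int p) * Legendre (int k) (int p))"
      unfolding a(1) by (simp add: Legendre_mult[OF pp] power2_eq_square)
    also have "\<dots> = Legendre (int a) (int p)" using Legendre_sign[OF k] by auto
    finally show ?thesis by simp
  qed
  then show ?thesis using a(2,3) cop(1) unfolding f_def M_def by blast
qed

text \<open>
  What quadratic reciprocity and its supplements leave of \<open>(-N/n)\<close> after the factors \<open>(n/p)\<close> for
  the odd primes \<open>p\<close> dividing the squarefree number \<open>N\<close> have been split off.
\<close>

definition two_part_character :: "nat \<Rightarrow> nat \<Rightarrow> int" where
  "two_part_character N n =
     (if (if even N then N div 2 else N) mod 4 = 1 then chi4 n else 1) * (if even N then chi8 n else 1)"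

lemma real_character_two_part:
  assumes "odd_primes P"
  shows "real_character (8 * \<Prod>P) (restricted (8 * \<Prod>P) (two_part_character N))"
proof (rule real_character_restricted)
  show "two_part_character N (m * n) = two_part_character N m * two_part_character N n" for m n
    by (simp add: two_part_character_def chi4_mult chi8_mult)
  show "two_part_character N (n + 8 * \<Prod>P) = two_part_character N n" for n
  proof -
    have "chi4 (n + 8 * k) = chi4 n" "chi8 (n + 8 * k) = chi8 n" for k
      using chi4_mod_8[of "n + 8 * k"] chi4_mod_8[of n] chi8_mod_8[of "n + 8 * k"] chi8_mod_8[of n]
      by simp_all
    then show ?thesis by (simp add: two_part_character_def)
  qed
  show "two_part_character N n = 1 \<or> two_part_character N n = -1" if "coprime n (8 * \<Prod>P)" for n
  proof -
    have "odd n" using that coprime_8_prod_iff[OF assms] by blast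
    then show ?thesis using chi4_odd[of n] chi8_odd[of n] by (auto simp: two_part_character_def)
  qed
qed

lemma quadratic_character_eq_Legendre:
  assumes P: "odd_primes P" and q: "prime q" "coprime q (8 * \<Prod>P)"
    and N: "N = \<Prod>P \<or> N = 2 * \<Prod>P"
  shows "quadratic_character P (two_part_character N) q = Legendre (- int N) (int q)"
proof -
  define m where "m = \<Prod>P"
  have "odd m" unfolding m_def by (rule odd_primes_prod_odd[OF P])
  have "odd q" "q \<notin> P" using q(2) coprime_8_prod_iff[OF P] by auto
  then have q2: "q > 2" using q(1) prime_ge_2_nat[of q] by (cases "q = 2") auto
  have N': "(if even N then N div 2 else N) = m" "even N \<longleftrightarrow> N = 2 * m" "N = m \<or> N = 2 * m"
    using N \<open>odd m\<close> unfolding m_def[symmetric] by auto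
  define L where "L = (\<Prod>p\<in>P. Legendre (int q) (int p))"
  have "quadratic_character P (two_part_character N) q = two_part_character N q * L"
    using q(2) by (simp add: quadratic_character_def Legendre_product_character L_def restricted_def
      principal_character_def)
  moreover have "Legendre (int m) (int q) = (if m mod 4 = 3 \<and> q mod 4 = 3 then -1 else 1) * L"
    unfolding m_def L_def by (rule Legendre_prod_reciprocity[OF P q(1) q2 \<open>q \<notin> P\<close>])
  moreover have "Legendre (- int m) (int q) = chi4 q * Legendre (int m) (int q)"
    using Legendre_mult[OF q(1) q2, of "-1" "int m"] Legendre_minus_one[OF q(1) q2] by simp
  moreover have "Legendre (- int (2 * m)) (int q) = chi8 q * Legendre (- int m) (int q)"
    using Legendre_mult[OF q(1) q2, of 2 "- int m"] Legendre_two[OF q(1) q2] by simp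
  \<comment> \<open>The reciprocity sign cancels (-1/q) when m = 3 modulo 4 and is absent when m = 1
    modulo 4; this explains the condition on \<open>chi4\<close> in
    \<open>two_part_character\<close>.\<close>
  moreover have "chi4 q * (if m mod 4 = 3 \<and> q mod 4 = 3 then -1 else 1) = (if m mod 4 = 1 then chi4 q else 1)"
  proof -
    have "m mod 4 = 1 \<or> m mod 4 = 3" "q mod 4 = 1 \<or> q mod 4 = 3"
      using \<open>odd m\<close> \<open>odd q\<close> by presburger+
    then show ?thesis by (auto simp: chi4_def)
  qed
  ultimately show ?thesis
    unfolding two_part_character_def N'(1) using N'(2,3) \<open>odd m\<close>
    by (elim disjE) (simp_all add: mult.assoc[symmetric] mult.commute[of "chi8 q"])
qed

lemma squarefree_odd_part:
  fixes N :: nat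
  assumes "squarefree N"
  obtains P where "odd_primes P" "N = \<Prod>P \<or> N = 2 * \<Prod>P"
proof -
  have N0: "N \<noteq> 0" using assms by (metis not_squarefree_0)
  define P where "P = prime_factors N - {2}"
  have "odd_primes P" unfolding odd_primes_def P_def
    by (auto dest!: in_prime_factors_imp_prime dest: prime_ge_2_nat intro: le_neq_implies_less)
  have "N = (\<Prod>p\<in>prime_factors N. p ^ multiplicity p N)"
    using prod_prime_factors[OF N0] by simp
  also have "\<dots> = \<Prod>(prime_factors N)"
    using assms squarefree_factorial_semiring'[OF N0] by (intro prod.cong) auto
  finally have N: "N = \<Prod>(prime_factors N)" .
  show ?thesis
  proof (cases "2 \<in> prime_factors N")
    case True
    then have "\<Prod>(prime_factors N) = 2 * \<Prod>P"
      unfolding P_def by (simp add: prod.remove)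
    then show ?thesis using that[OF \<open>odd_primes P\<close>] N by simp
  next
    case False
    then have "P = prime_factors N" by (simp add: P_def)
    then show ?thesis using that[OF \<open>odd_primes P\<close>] N by simp
  qed
qed

lemma prod_chi:
  "(\<Prod>p\<in>P. chi4 p) = chi4 (\<Prod>P)" "(\<Prod>p\<in>P. chi8 p) = chi8 (\<Prod>P)"
  by (induction P rule: infinite_finite_induct) (simp_all add: chi4_mult chi8_mult, simp_all add: chi4_def chi8_def)

text \<open>The number A is d a, with \<open>a\<close> split for (-N/n) and with symbols (a/p) =
  (-d/p) for all p in \<open>P\<close>. Then (-A/p) is a product of two equal signs, so
  \<open>-A\<close> is a square modulo every such p.\<close>

lemma squarefree_sum_three_squares:
  fixes N :: nat
  assumes "squarefree N" "N mod 8 \<noteq> 7"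
  shows "\<exists>x y z :: int. int N = x\<^sup>2 + y\<^sup>2 + z\<^sup>2"
proof -
  obtain P where P: "odd_primes P" and N: "N = \<Prod>P \<or> N = 2 * \<Prod>P"
    by (rule squarefree_odd_part[OF assms(1)])
  define m where "m = \<Prod>P"
  have "odd m" unfolding m_def by (rule odd_primes_prod_odd[OF P])
  have Nm: "N = m \<or> N = 2 * m" using N m_def by simp
  define \<psi> where "\<psi> = two_part_character N"
  \<comment> \<open>For \<open>N mod 8 = 3\<close> reciprocity rules out an odd \<open>A\<close>, so \<open>A\<close> is sought in the form \<open>2 * a\<close>.\<close>
  define d :: nat where "d = (if N mod 4 = 3 then 2 else 1)"
  define \<epsilon> where "\<epsilon> p = Legendre (- int d) (int p)" for p :: nat
  have \<epsilon>: "\<epsilon> p = 1 \<or> \<epsilon> p = -1" if "p \<in> P" for p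
  proof -
    have "p > 2" using odd_primesD(3)[OF P that] .
    then have "\<not> int p dvd - int d" using zdvd_not_zless[of "int d" "int p"] by (auto simp: d_def)
    then show ?thesis unfolding \<epsilon>_def by (rule Legendre_sign)
  qed
  have nontrivial: "(\<exists>c. odd c \<and> \<psi> c = -1) \<or> (\<forall>c. odd c \<longrightarrow> \<psi> c = 1) \<and> (\<Prod>p\<in>P. \<epsilon> p) = 1"
  proof (cases "even N")
    case True
    \<comment> \<open>As 5 is 1 modulo 4, a possible factor \<open>chi4\<close> is 1 there, whatever
      the odd part of \<open>N\<close>.\<close>
    then have "\<psi> 5 = -1" by (auto simp: \<psi>_def two_part_character_def chi4_def chi8_def)
    then show ?thesis by (intro disjI1 exI[of _ 5]) simp
  next
    case odd: False
    show ?thesis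
    proof (cases "N mod 4 = 1")
      case True
      then have "\<psi> 3 = -1" using odd by (auto simp: \<psi>_def two_part_character_def chi4_def)
      then show ?thesis by (intro disjI1 exI[of _ 3]) simp
    next
      case False
      then have N4: "N mod 4 = 3" using odd by presburger
      have "N mod 8 mod 4 = N mod 4" by (simp add: mod_mod_cancel)
      moreover have "N mod 8 < 8" by simp
      then have "N mod 8 \<in> {0, 1, 2, 3, 4, 5, 6, 7}" by auto
      \<comment> \<open>Here the residue 7 is excluded. The character \<psi> is trivial on odd
        arguments, and the product of the signs (-2/p) is \<open>chi4 N * chi8 N\<close>; this is 1
        for residue 3 but would be -1 for residue 7.\<close>
      ultimately have N8: "N mod 8 = 3" "N mod 4 = 3" using N4 assms(2) by auto
      have "N = m" using odd Nm by auto
      have "\<epsilon> p = chi4 p * chi8 p" if "p \<in> P" for p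
      proof -
        have pp: "prime p" "p > 2" using odd_primesD[OF P] that by auto
        show ?thesis using N8 Legendre_mult[OF pp, of "-1" 2] Legendre_minus_one[OF pp] Legendre_two[OF pp]
          by (simp add: \<epsilon>_def d_def)
      qed
      then have "(\<Prod>p\<in>P. \<epsilon> p) = chi4 m * chi8 m" by (simp add: prod.distrib prod_chi m_def)
      also have "\<dots> = 1" using N8 \<open>N = m\<close> by (simp add: chi4_def chi8_def)
      finally show ?thesis using odd False by (simp add: \<psi>_def two_part_character_def)
    qed
  qed
  have "\<psi> (n mod 8) = \<psi> n" for n by (simp add: \<psi>_def two_part_character_def chi4_mod_8 chi8_mod_8)
  moreover have "\<psi> 1 = 1" by (simp add: \<psi>_def two_part_character_def chi4_def chi8_def)
  ultimately obtain a where a: "squarefree a" "coprime a (8 * \<Prod>P)"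
    "\<forall>q. prime q \<longrightarrow> q dvd a \<longrightarrow> quadratic_character P \<psi> q = 1"
    "\<forall>p\<in>P. Legendre (int a) (int p) = \<epsilon> p"
    using exists_split_number[OF P, of \<psi> \<epsilon>] real_character_two_part[OF P] \<epsilon> nontrivial
    unfolding \<psi>_def by blast
  have "odd a" using a(2) coprime_8_prod_iff[OF P] by blast
  have d: "d = 1 \<or> d = 2 \<and> odd N" unfolding d_def by presburger
  have ndvd_2: "\<not> q dvd 2" if "prime q" "q \<noteq> 2" for q :: nat
    using that primes_dvd_imp_eq[of q 2] by auto
  \<comment> \<open>Every integer is its own square modulo 2, so the prime 2 imposes no condition on
    either side.\<close>
  have QuadRes_2: "QuadRes (int 2) D" for D
  proof -
    have "[D\<^sup>2 = D] (mod 2)" by (simp add: cong_iff_dvd_diff)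
    then show ?thesis unfolding QuadRes_def by auto
  qed
  show ?thesis
  proof (rule reciprocal_residues_imp_three_squares[OF assms(1), of "d * a"])
    have "squarefree d" using d squarefree_prime[of "2 :: nat"] by auto
    then show "squarefree (d * a)" using d \<open>odd a\<close> a(1)
      by (intro squarefree_mult_coprime) (auto simp: coprime_left_2_iff_odd)
    have "coprime a N" using a(2) N \<open>odd a\<close> by (auto simp: coprime_right_2_iff_odd)
    then show "coprime (d * a) N" using d by (auto simp: coprime_left_2_iff_odd)
    show "QuadRes (int q) (- int N)" if q: "prime q" "q dvd d * a" for q
    proof (cases "q = 2")
      case True
      then show ?thesis using QuadRes_2 by blast
    next
      case False
      then have "q dvd a" using q d ndvd_2[of q] by (auto simp: prime_dvd_mult_iff)
      have cop: "coprime q (8 * \<Prod>P)"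
        by (rule coprime_divisors[OF \<open>q dvd a\<close> dvd_refl a(2)])
      have "quadratic_character P \<psi> q = 1" using a(3) q(1) \<open>q dvd a\<close> by blast
      then have "Legendre (- int N) (int q) = 1"
        unfolding \<psi>_def quadratic_character_eq_Legendre[OF P q(1) cop N] .
      then show ?thesis by (rule Legendre_eq_1_imp_QuadRes)
    qed
    show "QuadRes (int p) (- int (d * a))" if p: "prime p" "p dvd N" for p
    proof (cases "p = 2")
      case True
      then show ?thesis using QuadRes_2 by blast
    next
      case False
      then have "p dvd \<Prod>P" using p N ndvd_2[of p] by (auto simp: prime_dvd_mult_iff)
      then obtain p' where "p' \<in> P" "p dvd p'"
        using prime_dvd_prod_iff[OF odd_primesD(1)[OF P] p(1), of "\<lambda>x. x"] by auto
      then have "p \<in> P" using p(1) odd_primesD(2)[OF P] primes_dvd_imp_eq by blast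
      have "p > 2" using odd_primesD(3)[OF P \<open>p \<in> P\<close>] .
      have "Legendre (- int (d * a)) (int p) = \<epsilon> p * Legendre (int a) (int p)"
        using Legendre_mult[OF p(1) \<open>p > 2\<close>, of "- int d" "int a"] by (simp add: \<epsilon>_def)
      also have "\<dots> = 1" using a(4) \<epsilon>[OF \<open>p \<in> P\<close>] \<open>p \<in> P\<close> by auto
      finally show ?thesis by (rule Legendre_eq_1_imp_QuadRes)
    qed
  qed
qed

section \<open>Sums of two, three and four squares\<close>

lemma odd_square_mod_8:
  fixes n :: nat
  assumes "odd n"
  shows "n\<^sup>2 mod 8 = 1"
proof -
  have "n mod 8 = 1 \<or> n mod 8 = 3 \<or> n mod 8 = 5 \<or> n mod 8 = 7" using assms by presburger
  moreover have "n\<^sup>2 mod 8 = (n mod 8)\<^sup>2 mod 8" by (simp add: power_mod)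
  ultimately show ?thesis by auto
qed

text \<open>Write n = a s^2 with \<open>a\<close> squarefree. If \<open>a\<close> were 7 modulo 8,
  then splitting \<open>s\<close> into a power of 2 and an odd number would put \<open>n\<close>
  into the excluded form; hence \<open>a\<close> is a sum of three squares, and scaling by
  \<open>s\<close> gives \<open>n\<close>.\<close>

lemma sum_three_squares:
  fixes n :: nat
  assumes "\<not> (\<exists>p q. n = 4 ^ p * (8 * q + 7))"
  shows "\<exists>x y z :: int. int n = x\<^sup>2 + y\<^sup>2 + z\<^sup>2"
proof (cases "n = 0")
  case True
  then show ?thesis by (intro exI[of _ 0]) simp
next
  case False
  define a s where "a = squarefree_part n" and "s = square_part n"
  have n: "n = a * s\<^sup>2" unfolding a_def s_def by (rule squarefree_decompose)
  then have s0: "s > 0" using False by (cases s) auto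
  have "a mod 8 \<noteq> 7"
  proof
    assume a7: "a mod 8 = 7"
    obtain j where j: "s = 2 ^ multiplicity 2 s * j" "\<not> 2 dvd j"
      using multiplicity_decompose'[of s 2] s0 by auto
    define i where "i = multiplicity 2 s"
    have "(a * j\<^sup>2) mod 8 = (a mod 8) * (j\<^sup>2 mod 8) mod 8" by (simp add: mod_mult_eq)
    also have "\<dots> = 7" using a7 odd_square_mod_8[OF j(2)] by simp
    finally have "a * j\<^sup>2 = 8 * (a * j\<^sup>2 div 8) + 7" using mult_div_mod_eq[of 8 "a * j\<^sup>2"] by linarith
    moreover have "n = 4 ^ i * (a * j\<^sup>2)"
    proof -
      have "s = 2 ^ i * j" using j(1) i_def by simp
      then have "n = (2 ^ i)\<^sup>2 * (a * j\<^sup>2)" unfolding n by (simp add: power_mult_distrib mult_ac)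
      then show ?thesis by (simp add: power_even_eq[symmetric] power_mult[symmetric] mult.commute[of i 2] power_mult)
    qed
    ultimately show False using assms by metis
  qed
  then obtain x y z where xyz: "int a = x\<^sup>2 + y\<^sup>2 + z\<^sup>2"
    using squarefree_sum_three_squares[of a] a_def by auto
  have "int n = (int s * x)\<^sup>2 + (int s * y)\<^sup>2 + (int s * z)\<^sup>2"
    unfolding n power_mult_distrib by (simp add: xyz algebra_simps)
  then show ?thesis by blast
qed

section \<open>Squares modulo 8, exclusions for three squares, and four squares\<close>

lemma square_mod_8:
  fixes x :: int
  shows "odd x \<Longrightarrow> x\<^sup>2 mod 8 = 1" "even x \<Longrightarrow> x\<^sup>2 mod 8 = 0 \<or> x\<^sup>2 mod 8 = 4"
proof -
  have *: "x\<^sup>2 mod 8 = (x mod 8)\<^sup>2 mod 8" by (simp add: power_mod)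
  show "x\<^sup>2 mod 8 = 1" if "odd x"
  proof -
    have "x mod 8 = 1 \<or> x mod 8 = 3 \<or> x mod 8 = 5 \<or> x mod 8 = 7" using that by presburger
    then show ?thesis unfolding * by auto
  qed
  show "x\<^sup>2 mod 8 = 0 \<or> x\<^sup>2 mod 8 = 4" if "even x"
  proof -
    have "x mod 8 = 0 \<or> x mod 8 = 2 \<or> x mod 8 = 4 \<or> x mod 8 = 6" using that by presburger
    then show ?thesis unfolding * by auto
  qed
qed

lemma three_squares_mod_8:
  fixes x y z :: int
  defines "r \<equiv> (x\<^sup>2 + y\<^sup>2 + z\<^sup>2) mod 8"
  shows "r \<noteq> 7" "r = 0 \<or> r = 4 \<Longrightarrow> even x \<and> even y \<and> even z"
proof -
  define X Y Z where "X = x\<^sup>2 mod 8" and "Y = y\<^sup>2 mod 8" and "Z = z\<^sup>2 mod 8"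
  have r: "r = (X + Y + Z) mod 8"
    unfolding r_def X_def Y_def Z_def by (metis mod_add_eq mod_add_left_eq)
  have X: "X = 0 \<and> even x \<or> X = 1 \<or> X = 4 \<and> even x"
    and Y: "Y = 0 \<and> even y \<or> Y = 1 \<or> Y = 4 \<and> even y"
    and Z: "Z = 0 \<and> even z \<or> Z = 1 \<or> Z = 4 \<and> even z"
    unfolding X_def Y_def Z_def using square_mod_8 by blast+
  show "r \<noteq> 7" unfolding r using X Y Z by (elim disjE conjE) simp_all
  show "even x \<and> even y \<and> even z" if "r = 0 \<or> r = 4"
    using that X Y Z unfolding r by (elim disjE conjE) simp_all
qed

text \<open>Descent on \<open>p\<close>: a sum of three squares divisible by 4 has all its terms
  even, so halving the variables removes a factor 4, until the unattainable residue 7 modulo 8 is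
  left.\<close>

lemma not_sum_three_squares:
  fixes x y z :: int
  shows "x\<^sup>2 + y\<^sup>2 + z\<^sup>2 \<noteq> 4 ^ p * (8 * q + 7)"
proof (induction p arbitrary: x y z)
  case 0
  show ?case
  proof
    assume "x\<^sup>2 + y\<^sup>2 + z\<^sup>2 = 4 ^ 0 * (8 * q + 7)"
    then have "(x\<^sup>2 + y\<^sup>2 + z\<^sup>2) mod 8 = 7" by simp
    then show False using three_squares_mod_8(1)[of x y z] by simp
  qed
next
  case (Suc p)
  show ?case
  proof
    assume *: "x\<^sup>2 + y\<^sup>2 + z\<^sup>2 = 4 ^ Suc p * (8 * q + 7)"
    have "(4 * m) mod 8 = 0 \<or> (4 * m) mod 8 = 4" for m :: int by presburger
    then have "(x\<^sup>2 + y\<^sup>2 + z\<^sup>2) mod 8 = 0 \<or> (x\<^sup>2 + y\<^sup>2 + z\<^sup>2) mod 8 = 4"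
      unfolding * power_Suc mult.assoc by blast
    then have "even x \<and> even y \<and> even z" by (rule three_squares_mod_8(2))
    then obtain x' y' z' where "x = 2 * x'" "y = 2 * y'" "z = 2 * z'" by (meson evenE)
    then have "x'\<^sup>2 + y'\<^sup>2 + z'\<^sup>2 = 4 ^ p * (8 * q + 7)" using * by simp
    then show False using Suc.IH by blast
  qed
qed

text \<open>For \<open>n\<close> of the excluded form 4^p (8 q + 7), the number 8 q + 6 is a sum of
  three squares, being neither odd nor divisible by 4. Adding 1 and scaling by 2^p gives
  \<open>n\<close>.\<close>

lemma sum_four_squares:
  fixes n :: nat
  shows "\<exists>w x y z :: int. int n = w\<^sup>2 + x\<^sup>2 + y\<^sup>2 + z\<^sup>2"
proof (cases "\<exists>p q. n = 4 ^ p * (8 * q + 7)")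
  case True
  then obtain p q where n: "n = 4 ^ p * (8 * q + 7)" by blast
  have "\<not> (\<exists>i j. 8 * q + 6 = 4 ^ i * (8 * j + 7))"
  proof
    assume "\<exists>i j. 8 * q + 6 = 4 ^ i * (8 * j + 7)"
    then obtain i j where ij: "8 * q + 6 = 4 ^ i * (8 * j + 7)" by blast
    show False
    proof (cases i)
      case 0
      then show False using ij by simp presburger
    next
      case (Suc k)
      then have "4 dvd 8 * q + 6" using ij by simp
      then show False by presburger
    qed
  qed
  then obtain x y z where xyz: "int (8 * q + 6) = x\<^sup>2 + y\<^sup>2 + z\<^sup>2" using sum_three_squares by blast
  have four: "(4 :: int) ^ p = (2 ^ p)\<^sup>2" by (simp add: power_mult[symmetric] mult.commute[of p 2] power_mult)
  have "int n = (2 ^ p * 1)\<^sup>2 + (2 ^ p * x)\<^sup>2 + (2 ^ p * y)\<^sup>2 + (2 ^ p * z)\<^sup>2"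
  proof -
    have "int n = 4 ^ p * (1 + int (8 * q + 6))" by (simp add: n)
    then show ?thesis unfolding power_mult_distrib four[symmetric] xyz by (simp add: algebra_simps)
  qed
  then show ?thesis by blast
next
  case False
  then obtain x y z :: int where "int n = x\<^sup>2 + y\<^sup>2 + z\<^sup>2" using sum_three_squares by blast
  then have "int n = 0\<^sup>2 + x\<^sup>2 + y\<^sup>2 + z\<^sup>2" by simp
  then show ?thesis by blast
qed

section \<open>Sums of two squares\<close>

lemma not_QuadRes_minus_one:
  assumes "prime p" "p mod 4 = 3"
  shows "\<not> QuadRes (int p) (-1)"
proof
  assume "QuadRes (int p) (-1)"
  have p: "p > 2" using assms by (cases "p = 2") (auto dest: prime_ge_2_nat intro: le_neq_implies_less)
  have "\<not> int p dvd 1" using p by simp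
  then have "Legendre (-1) (int p) = 1"
    using \<open>QuadRes (int p) (-1)\<close> by (simp add: Legendre_def cong_0_iff)
  then show False using Legendre_minus_one[OF assms(1) p] assms(2) by (simp add: chi4_def)
qed

text \<open>If \<open>p\<close> did not divide \<open>y\<close>, then x / y modulo \<open>p\<close>
  would be a square root of -1.\<close>

lemma prime_3_mod_4_dvd_sum_squares:
  fixes x y :: int
  assumes p: "prime p" "p mod 4 = 3" and dvd: "int p dvd x\<^sup>2 + y\<^sup>2"
  shows "int p dvd x \<and> int p dvd y"
proof -
  have pi: "prime (int p)" using p(1) by simp
  have y: "int p dvd y"
  proof (rule ccontr)
    assume "\<not> int p dvd y"
    then have "coprime (int p) y" using pi prime_imp_coprime by blast
    then have "coprime y (int p)" by (simp add: coprime_commute)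
    then obtain i where i: "[y * i = 1] (mod int p)" using cong_solve_coprime_int by blast
    have "[x\<^sup>2 = - y\<^sup>2] (mod int p)" using dvd by (simp add: cong_iff_dvd_diff)
    then have "[x\<^sup>2 * i\<^sup>2 = - y\<^sup>2 * i\<^sup>2] (mod int p)" by (intro cong_mult) auto
    also have "- y\<^sup>2 * i\<^sup>2 = - ((y * i)\<^sup>2)" by (simp add: power_mult_distrib)
    also have "[- ((y * i)\<^sup>2) = - (1\<^sup>2)] (mod int p)" using cong_pow[OF i, of 2] by (simp add: cong_minus_minus_iff)
    finally have "[(x * i)\<^sup>2 = -1] (mod int p)" by (simp add: power_mult_distrib)
    then show False using not_QuadRes_minus_one[OF p] unfolding QuadRes_def by blast
  qed
  then have "int p dvd y\<^sup>2" by (simp add: power2_eq_square)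
  then have "int p dvd x\<^sup>2" using dvd dvd_add_left_iff by blast
  then show ?thesis using y pi prime_dvd_power by blast
qed

text \<open>Descent: when \<open>p\<close> divides the sum it divides both variables, and cancelling
  p^2 lowers the multiplicity by 2.\<close>

lemma even_multiplicity_sum_squares:
  fixes x y :: int
  assumes p: "prime p" "p mod 4 = 3" and "x\<^sup>2 + y\<^sup>2 \<noteq> 0"
  shows "even (multiplicity (int p) (x\<^sup>2 + y\<^sup>2))"
  using assms(3)
proof (induction "nat (x\<^sup>2 + y\<^sup>2)" arbitrary: x y rule: less_induct)
  case less
  show ?case
  proof (cases "int p dvd x\<^sup>2 + y\<^sup>2")
    case False
    then show ?thesis by (simp add: not_dvd_imp_multiplicity_0)
  next
    case True
    then obtain x' y' where x: "x = int p * x'" and y: "y = int p * y'"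
      using prime_3_mod_4_dvd_sum_squares[OF p] by (meson dvdE)
    define m where "m = x'\<^sup>2 + y'\<^sup>2"
    have eq: "x\<^sup>2 + y\<^sup>2 = (int p)\<^sup>2 * m" unfolding x y m_def by (simp add: power_mult_distrib algebra_simps)
    have m0: "m \<noteq> 0" using less.prems eq by auto
    have mpos: "m > 0" using m0 unfolding m_def by (simp add: less_le)
    have "1 < (int p)\<^sup>2" using prime_gt_1_nat[OF p(1)] by (simp add: one_less_power)
    then have "1 * m < (int p)\<^sup>2 * m" using mpos by (intro mult_strict_right_mono)
    then have "m < (int p)\<^sup>2 * m" by simp
    then have lt: "nat (x'\<^sup>2 + y'\<^sup>2) < nat (x\<^sup>2 + y\<^sup>2)"
      unfolding eq m_def[symmetric] by (subst nat_less_eq_zless) (use mpos in auto)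
    have pi: "prime (int p)" using p(1) by simp
    have "multiplicity (int p) ((int p)\<^sup>2 * m) = 2 + multiplicity (int p) m"
      using pi m0 by (subst prime_elem_multiplicity_mult_distrib)
        (auto simp: multiplicity_same_power prime_gt_0_int)
    then show ?thesis using less.hyps[OF lt] m0 unfolding eq m_def by simp
  qed
qed

text \<open>A prime dividing the squarefree part \<open>a\<close> has odd exponent in
  \<open>n\<close>, so it is not 3 modulo 4. Hence -1 is a square modulo \<open>a\<close>, and
  \<open>a\<close> is the leading entry of a binary form of determinant 1.\<close>

lemma sum_two_squares:
  fixes n :: nat
  assumes "n > 0" "\<And>p. prime p \<Longrightarrow> p mod 4 = 3 \<Longrightarrow> even (multiplicity p n)"
  shows "\<exists>x y :: int. int n = x\<^sup>2 + y\<^sup>2"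
proof -
  define a s where "a = squarefree_part n" and "s = square_part n"
  have n: "n = a * s\<^sup>2" unfolding a_def s_def by (rule squarefree_decompose)
  have a0: "a > 0" using n assms(1) by (cases a) auto
  have "QuadRes (int q) (-1)" if q: "prime q" "q dvd a" for q
  proof (cases "q = 2")
    case True
    have "[1\<^sup>2 = -1] (mod (2 :: int))" by (simp add: cong_def)
    then show ?thesis unfolding QuadRes_def True of_nat_numeral by blast
  next
    case False
    then have q2: "q > 2" using prime_ge_2_nat[OF q(1)] by simp
    have "multiplicity q a > 0" using q a0 by (simp add: prime_multiplicity_gt_zero_iff)
    then have "odd (multiplicity q n)"
      unfolding a_def prime_multiplicity_squarefree_part[OF q(1)] by presburger
    then have "q mod 4 \<noteq> 3" using assms(2) q(1) by blast
    moreover have "odd q" using q(1) q2 prime_odd_nat by simp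
    ultimately have "q mod 4 = 1" by presburger
    then have "Legendre (-1) (int q) = 1" using Legendre_minus_one[OF q(1) q2] by (simp add: chi4_def)
    then show ?thesis by (rule Legendre_eq_1_imp_QuadRes)
  qed
  moreover have "squarefree a" by (simp add: a_def)
  ultimately have "QuadRes (int a) (-1)" by (metis QuadRes_squarefree)
  then obtain h where "[h\<^sup>2 = -1] (mod int a)" unfolding QuadRes_def by blast
  then have "int a dvd h\<^sup>2 + 1" by (simp add: cong_iff_dvd_diff)
  then obtain c where "int a * c = h\<^sup>2 + 1" by (metis dvdE)
  then obtain x y where xy: "int a = x\<^sup>2 + y\<^sup>2" using binary_gram_matrix[of "int a" c h] a0 by auto
  have "int n = (int s * x)\<^sup>2 + (int s * y)\<^sup>2"
    unfolding n power_mult_distrib by (simp add: xy algebra_simps)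
  then show ?thesis by blast
qed

lemma multiplicity_of_nat:
  fixes p n :: nat
  assumes "prime p" "n > 0"
  shows "multiplicity (int p) (int n) = multiplicity p n"
proof (rule multiplicity_eqI)
  show "int p ^ multiplicity p n dvd int n"
    using multiplicity_dvd[of p n] by (metis of_nat_dvd_iff of_nat_power)
  have "\<not> p ^ Suc (multiplicity p n) dvd n"
    using assms not_prime_unit[of p]
    by (subst power_dvd_iff_le_multiplicity) auto
  then show "\<not> int p ^ Suc (multiplicity p n) dvd int n"
    by (metis of_nat_dvd_iff of_nat_power)
qed

lemma sum_two_squares_iff:
  fixes k :: int
  shows "(\<exists>x y. x\<^sup>2 + y\<^sup>2 = k) \<longleftrightarrow> k = 0 \<or>
    (k > 0 \<and> (\<forall>r :: int. prime r \<and> (\<exists>p :: int. r = 4 * p - 1) \<and> r dvd k \<longrightarrow> even (multiplicity r k)))"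
    (is "?L \<longleftrightarrow> ?R")
proof
  assume ?L
  then obtain x y where k: "k = x\<^sup>2 + y\<^sup>2" by blast
  show ?R
  proof (cases "k = 0")
    case False
    have "k > 0" using False k by (simp add: less_le)
    moreover have "even (multiplicity r k)" if r: "prime r" "\<exists>p. r = 4 * p - 1" for r
    proof -
      obtain n where rn: "r = int n" using prime_ge_0_int[OF r(1)] nonneg_int_cases by blast
      have "prime n" using r(1) rn by simp
      moreover have "n mod 4 = 3" using r(2) rn by presburger
      ultimately show ?thesis
        using even_multiplicity_sum_squares[of n x y] False k rn by simp
    qed
    ultimately show ?thesis by blast
  qed simp
next
  assume R: ?R
  show ?L
  proof (cases "k = 0")
    case True
    then show ?thesis by (intro exI[of _ 0]) simp
  next
    case False
    then have kpos: "k > 0" using R by blast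
    define n where "n = nat k"
    have kn: "k = int n" "n > 0" using kpos by (auto simp: n_def)
    have "even (multiplicity p n)" if p: "prime p" "p mod 4 = 3" for p
    proof (cases "p dvd n")
      case True
      have "int p = 4 * (int (p div 4) + 1) - 1" using p(2) by presburger
      moreover have "prime (int p)" "int p dvd k" using p(1) True kn by auto
      ultimately have "even (multiplicity (int p) k)" using R False by blast
      then show ?thesis using multiplicity_of_nat[OF p(1) kn(2)] kn(1) by simp
    next
      case False
      then show ?thesis by (simp add: not_dvd_imp_multiplicity_0)
    qed
    then show ?thesis using sum_two_squares[OF kn(2)] kn(1) by metis
  qed
qed

lemma sum_three_squares_iff:
  fixes k :: int
  shows "(\<exists>x y z. x\<^sup>2 + y\<^sup>2 + z\<^sup>2 = k) \<longleftrightarrow> k \<ge> 0 \<and> \<not> (\<exists>p q :: nat. k = 4 ^ p * (8 * int q + 7))"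
proof
  assume "\<exists>x y z. x\<^sup>2 + y\<^sup>2 + z\<^sup>2 = k"
  then show "k \<ge> 0 \<and> \<not> (\<exists>p q :: nat. k = 4 ^ p * (8 * int q + 7))"
    using not_sum_three_squares by auto
next
  assume k: "k \<ge> 0 \<and> \<not> (\<exists>p q :: nat. k = 4 ^ p * (8 * int q + 7))"
  have "\<not> (\<exists>p q. nat k = 4 ^ p * (8 * q + 7))"
  proof
    assume "\<exists>p q. nat k = 4 ^ p * (8 * q + 7)"
    then obtain p q where "nat k = 4 ^ p * (8 * q + 7)" by blast
    then have "int (nat k) = int (4 ^ p * (8 * q + 7))" by (rule arg_cong)
    then have "k = 4 ^ p * (8 * int q + 7)" using k by simp
    then show False using k by blast
  qed
  then show "\<exists>x y z. x\<^sup>2 + y\<^sup>2 + z\<^sup>2 = k" using sum_three_squares[of "nat k"] k by auto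
qed

lemma difference_two_squares_iff:
  fixes k :: int
  shows "(\<exists>x y. x\<^sup>2 - y\<^sup>2 = k) \<longleftrightarrow> \<not> (\<exists>p. k = 4 * p + 2)"
proof
  assume "\<exists>x y. x\<^sup>2 - y\<^sup>2 = k"
  then obtain x y where "x\<^sup>2 - y\<^sup>2 = k" by blast
  then have k: "k mod 8 = (x\<^sup>2 mod 8 - y\<^sup>2 mod 8) mod 8" using mod_diff_eq[of "x\<^sup>2" 8 "y\<^sup>2"] by simp
  define X Y where "X = x\<^sup>2 mod 8" and "Y = y\<^sup>2 mod 8"
  have "X = 0 \<or> X = 1 \<or> X = 4" "Y = 0 \<or> Y = 1 \<or> Y = 4"
    unfolding X_def Y_def using square_mod_8 by blast+
  then have "k mod 8 \<noteq> 2 \<and> k mod 8 \<noteq> 6"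
    unfolding k X_def[symmetric] Y_def[symmetric] by (elim disjE) simp_all
  moreover have "(4 * p + 2) mod 8 = 2 \<or> (4 * p + 2) mod 8 = 6" for p :: int by presburger
  ultimately show "\<not> (\<exists>p. k = 4 * p + 2)" by blast
next
  assume "\<not> (\<exists>p. k = 4 * p + 2)"
  then have "(\<exists>p. k = 4 * p) \<or> (\<exists>p. k = 2 * p + 1)" by presburger
  then consider p where "k = 4 * p" | p where "k = 2 * p + 1" by blast
  then show "\<exists>x y. x\<^sup>2 - y\<^sup>2 = k"
  proof cases
    case 1
    then have "(p + 1)\<^sup>2 - (p - 1)\<^sup>2 = k" by (simp add: power2_eq_square algebra_simps)
    then show ?thesis by blast
  next
    case 2
    then have "(p + 1)\<^sup>2 - p\<^sup>2 = k" by (simp add: power2_eq_square algebra_simps)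
    then show ?thesis by blast
  qed
qed

section \<open>The Diophantine equation\<close>

text \<open>The form reads only the indices of the tuple, so an arbitrary function can be restricted
  to an extensional one; from here on witnesses need not be extensional.\<close>

lemma has_solution_iff: "has_solution a b c k \<longleftrightarrow> (\<exists>p. dioph_form a b c p = k)"
proof
  assume "\<exists>p. dioph_form a b c p = k"
  then obtain p where p: "dioph_form a b c p = k" by blast
  define q where "q = restrict p {1..a + b + 2 * c}"
  have "dioph_form a b c q = dioph_form a b c p"
    unfolding dioph_form_def by (intro arg_cong2[where f = "(+)"] arg_cong2[where f = "(-)"]
      arg_cong2[where f = "(*)"] sum.cong refl) (auto simp: q_def)
  moreover have "q \<in> {1..a + b + 2 * c} \<rightarrow>\<^sub>E UNIV" by (simp add: q_def)
  ultimately show "has_solution a b c k"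
    using p unfolding has_solution_def dioph_solutions_def by auto
qed (auto simp: has_solution_def dioph_solutions_def)

lemma has_solution_squares_iff: "has_solution a 0 0 k \<longleftrightarrow> (\<exists>p. (\<Sum>i=1..a. (p i)\<^sup>2) = k)"
  by (simp add: has_solution_iff dioph_form_def)

lemma has_solution_neg: "has_solution 0 b 0 k \<longleftrightarrow> has_solution b 0 0 (- k)"
proof -
  have "dioph_form 0 b 0 p = - dioph_form b 0 0 p" for p by (simp add: dioph_form_def)
  then show ?thesis unfolding has_solution_iff by (metis minus_minus)
qed

lemma has_solution_1_iff: "has_solution 1 0 0 k \<longleftrightarrow> (\<exists>x. k = x\<^sup>2)"
proof
  assume "\<exists>x. k = x\<^sup>2"
  then obtain x where "k = x\<^sup>2" by blast
  then show "has_solution 1 0 0 k" unfolding has_solution_squares_iff by (intro exI[of _ "\<lambda>_. x"]) simp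
qed (auto simp: has_solution_squares_iff)

lemma has_solution_2_iff: "has_solution 2 0 0 k \<longleftrightarrow> (\<exists>x y. x\<^sup>2 + y\<^sup>2 = k)"
proof
  assume "\<exists>x y. x\<^sup>2 + y\<^sup>2 = k"
  then obtain x y where "x\<^sup>2 + y\<^sup>2 = k" by blast
  then show "has_solution 2 0 0 k" unfolding has_solution_squares_iff
    by (intro exI[of _ "\<lambda>i. if i = 1 then x else y"]) (simp add: numeral_2_eq_2)
qed (auto simp: has_solution_squares_iff numeral_2_eq_2)

lemma has_solution_3_iff: "has_solution 3 0 0 k \<longleftrightarrow> (\<exists>x y z. x\<^sup>2 + y\<^sup>2 + z\<^sup>2 = k)"
proof
  assume "\<exists>x y z. x\<^sup>2 + y\<^sup>2 + z\<^sup>2 = k"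
  then obtain x y z where "x\<^sup>2 + y\<^sup>2 + z\<^sup>2 = k" by blast
  then show "has_solution 3 0 0 k" unfolding has_solution_squares_iff
    by (intro exI[of _ "\<lambda>i. if i = 1 then x else if i = 2 then y else z"]) (simp add: numeral_3_eq_3 numeral_2_eq_2)
next
  assume "has_solution 3 0 0 k"
  then obtain p :: "nat \<Rightarrow> int" where "(\<Sum>i=1..3. (p i)\<^sup>2) = k" unfolding has_solution_squares_iff by blast
  then have "(p 1)\<^sup>2 + (p 2)\<^sup>2 + (p 3)\<^sup>2 = k" by (simp add: numeral_3_eq_3 numeral_2_eq_2)
  then show "\<exists>x y z. x\<^sup>2 + y\<^sup>2 + z\<^sup>2 = k" by blast
qed

lemma has_solution_1_1_iff: "has_solution 1 1 0 k \<longleftrightarrow> (\<exists>x y. x\<^sup>2 - y\<^sup>2 = k)"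
proof
  assume "\<exists>x y. x\<^sup>2 - y\<^sup>2 = k"
  then obtain x y where "x\<^sup>2 - y\<^sup>2 = k" by blast
  then show "has_solution 1 1 0 k" unfolding has_solution_iff dioph_form_def
    by (intro exI[of _ "\<lambda>i. if i = 1 then x else y"]) simp
qed (auto simp: has_solution_iff dioph_form_def)

lemma has_solution_ge_4_iff:
  assumes "a \<ge> 4"
  shows "has_solution a 0 0 k \<longleftrightarrow> k \<ge> 0"
proof
  assume "has_solution a 0 0 k"
  then show "k \<ge> 0" unfolding has_solution_squares_iff by (auto intro: sum_nonneg)
next
  assume "k \<ge> 0"
  then obtain w x y z where k: "k = w\<^sup>2 + x\<^sup>2 + y\<^sup>2 + z\<^sup>2" using sum_four_squares[of "nat k"] by auto
  define p :: "nat \<Rightarrow> int" where "p i = (if i = 1 then w else if i = 2 then x else if i = 3 then y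
    else if i = 4 then z else 0)" for i
  have "(\<Sum>i=1..a. (p i)\<^sup>2) = (\<Sum>i=1..4. (p i)\<^sup>2)"
    using assms by (intro sum.mono_neutral_right) (auto simp: p_def)
  also have "\<dots> = k" unfolding k p_def by (simp add: numeral_eq_Suc)
  finally show "has_solution a 0 0 k" unfolding has_solution_squares_iff by blast
qed

text \<open>The first square variable, if there is one, is set to the parity \<open>e\<close> of
  \<open>k\<close>, where e^2 = e. The remaining even number is 2 * 1 * y, from one hyperbolic pair;
  all other variables are 0.\<close>

lemma has_solution_hyperbolic:
  assumes "c \<ge> 1" "a + b \<ge> 1 \<or> even k"
  shows "has_solution a b c k"
proof -
  define e where "e = k mod 2"
  \<comment> \<open>The contribution of the squares: index 1 carries a minus sign when
    \<open>a = 0\<close> and \<open>b \<ge> 1\<close>.\<close>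
  define s where "s = (if a \<ge> 1 then e else if b \<ge> 1 then - e else 0)"
  define y where "y = (k - s) div 2"
  \<comment> \<open>For \<open>a = b = 0\<close> index 1 belongs to the hyperbolic pair, so the pair
    is tested before the square variable.\<close>
  define p :: "nat \<Rightarrow> int" where
    "p i = (if i = a + b + 1 then 1 else if i = a + b + 2 then y else if i = 1 then e else 0)" for i
  have "even (k - s)" unfolding s_def e_def using assms(2) by auto
  then have k: "s + 2 * y = k" unfolding y_def by simp
  have "e\<^sup>2 = e" unfolding e_def by (cases "even k") (auto simp: odd_iff_mod_2_eq_one)
  have "(\<Sum>i=1..a. (p i)\<^sup>2) = (\<Sum>i=1..a. if i = 1 then e else 0)"
    using \<open>e\<^sup>2 = e\<close> by (intro sum.cong) (auto simp: p_def)
  also have "\<dots> = (if a \<ge> 1 then e else 0)" by (simp add: sum.delta)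
  finally have 1: "(\<Sum>i=1..a. (p i)\<^sup>2) = (if a \<ge> 1 then e else 0)" .
  have "(\<Sum>i=1..b. (p (a + i))\<^sup>2) = (\<Sum>i=1..b. if i = 1 then (if a = 0 then e else 0) else 0)"
    using \<open>e\<^sup>2 = e\<close> by (intro sum.cong) (auto simp: p_def)
  also have "\<dots> = (if b \<ge> 1 \<and> a = 0 then e else 0)" by (simp add: sum.delta)
  finally have 2: "(\<Sum>i=1..b. (p (a + i))\<^sup>2) = (if b \<ge> 1 \<and> a = 0 then e else 0)" .
  have "(\<Sum>i=1..c. p (a + b + 2 * i - 1) * p (a + b + 2 * i)) = (\<Sum>i=1..c. if i = 1 then y else 0)"
    by (intro sum.cong) (auto simp: p_def)
  also have "\<dots> = y" using assms(1) by (simp add: sum.delta)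
  finally have 3: "(\<Sum>i=1..c. p (a + b + 2 * i - 1) * p (a + b + 2 * i)) = y" .
  have "dioph_form a b c p = s + 2 * y"
    unfolding dioph_form_def 1 2 3 s_def by auto
  then show ?thesis unfolding has_solution_iff using k by blast
qed

theorem theorem4p5:
  fixes a b c :: nat and k :: int
  shows
    "((a \<ge> 1 \<or> b \<ge> 1) \<and> c \<ge> 1 \<longrightarrow> has_solution a b c k)
   \<and> (a \<ge> 4 \<and> b = 0 \<and> c = 0 \<longrightarrow>
        (k \<ge> 0 \<longrightarrow> has_solution a b c k) \<and> (k < 0 \<longrightarrow> \<not> has_solution a b c k))
   \<and> (b \<ge> 4 \<and> a = 0 \<and> c = 0 \<longrightarrow>
        (k \<le> 0 \<longrightarrow> has_solution a b c k) \<and> (k > 0 \<longrightarrow> \<not> has_solution a b c k))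
   \<and> (a = 3 \<and> b = 0 \<and> c = 0 \<longrightarrow>
        (k \<ge> 0 \<and> \<not> (\<exists>p q :: nat. k = 4 ^ p * (8 * int q + 7)) \<longrightarrow> has_solution a b c k) \<and>
        ((\<exists>p q :: nat. k = 4 ^ p * (8 * int q + 7)) \<or> k < 0 \<longrightarrow> \<not> has_solution a b c k))
   \<and> (b = 3 \<and> a = 0 \<and> c = 0 \<longrightarrow>
        (k \<le> 0 \<and> \<not> (\<exists>p q :: nat. k = - (4 ^ p * (8 * int q + 7))) \<longrightarrow> has_solution a b c k) \<and>
        ((\<exists>p q :: nat. k = - (4 ^ p * (8 * int q + 7))) \<or> k > 0 \<longrightarrow> \<not> has_solution a b c k))
   \<and> (a = 2 \<and> b = 0 \<and> c = 0 \<longrightarrow>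
        (has_solution a b c k \<longleftrightarrow>
           k = 0 \<or>
           (k > 0 \<and> (\<forall>r :: int. prime r \<and> (\<exists>p :: int. r = 4 * p - 1) \<and> r dvd k
                        \<longrightarrow> even (multiplicity r k)))))
   \<and> (b = 2 \<and> a = 0 \<and> c = 0 \<longrightarrow>
        (has_solution a b c k \<longleftrightarrow>
           k = 0 \<or>
           (k < 0 \<and> (\<forall>r :: int. prime r \<and> (\<exists>p :: int. r = 4 * p - 1) \<and> r dvd \<bar>k\<bar>
                        \<longrightarrow> even (multiplicity r \<bar>k\<bar>)))))
   \<and> (a = 1 \<and> b = 1 \<and> c = 0 \<longrightarrow>
        (\<not> (\<exists>p :: int. k = 4 * p + 2) \<longrightarrow> has_solution a b c k) \<and>
        ((\<exists>p :: int. k = 4 * p + 2) \<longrightarrow> \<not> has_solution a b c k))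
   \<and> (a = 1 \<and> b = 0 \<and> c = 0 \<longrightarrow>
        (has_solution a b c k \<longleftrightarrow> (\<exists>m :: int. k = m\<^sup>2)))
   \<and> (b = 1 \<and> a = 0 \<and> c = 0 \<longrightarrow>
        (has_solution a b c k \<longleftrightarrow> (\<exists>m :: int. - k = m\<^sup>2)))
   \<and> (a = 0 \<and> b = 0 \<and> c \<ge> 1 \<longrightarrow>
        (even k \<longrightarrow> has_solution a b c k))"
proof (intro conjI)
  show "(a \<ge> 1 \<or> b \<ge> 1) \<and> c \<ge> 1 \<longrightarrow> has_solution a b c k"
    using has_solution_hyperbolic[of c a b k] by linarith
  show "a \<ge> 4 \<and> b = 0 \<and> c = 0 \<longrightarrow>
      (k \<ge> 0 \<longrightarrow> has_solution a b c k) \<and> (k < 0 \<longrightarrow> \<not> has_solution a b c k)"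
    using has_solution_ge_4_iff[of a k] by auto
  show "b \<ge> 4 \<and> a = 0 \<and> c = 0 \<longrightarrow>
      (k \<le> 0 \<longrightarrow> has_solution a b c k) \<and> (k > 0 \<longrightarrow> \<not> has_solution a b c k)"
    using has_solution_ge_4_iff[of b "- k"] has_solution_neg[of b k] by auto
  show "a = 3 \<and> b = 0 \<and> c = 0 \<longrightarrow>
      (k \<ge> 0 \<and> \<not> (\<exists>p q :: nat. k = 4 ^ p * (8 * int q + 7)) \<longrightarrow> has_solution a b c k) \<and>
      ((\<exists>p q :: nat. k = 4 ^ p * (8 * int q + 7)) \<or> k < 0 \<longrightarrow> \<not> has_solution a b c k)"
    using has_solution_3_iff[of k] sum_three_squares_iff[of k] by (metis not_less)
  have "(k = - (4 ^ p * (8 * int q + 7))) \<longleftrightarrow> (- k = 4 ^ p * (8 * int q + 7))" for p q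
    by linarith
  then show "b = 3 \<and> a = 0 \<and> c = 0 \<longrightarrow>
      (k \<le> 0 \<and> \<not> (\<exists>p q :: nat. k = - (4 ^ p * (8 * int q + 7))) \<longrightarrow> has_solution a b c k) \<and>
      ((\<exists>p q :: nat. k = - (4 ^ p * (8 * int q + 7))) \<or> k > 0 \<longrightarrow> \<not> has_solution a b c k)"
    using has_solution_3_iff[of "- k"] sum_three_squares_iff[of "- k"] has_solution_neg[of 3 k]
    by (metis neg_0_le_iff_le not_less)
  show "a = 2 \<and> b = 0 \<and> c = 0 \<longrightarrow>
      (has_solution a b c k \<longleftrightarrow> k = 0 \<or>
        (k > 0 \<and> (\<forall>r :: int. prime r \<and> (\<exists>p :: int. r = 4 * p - 1) \<and> r dvd k
                     \<longrightarrow> even (multiplicity r k))))"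
    using has_solution_2_iff[of k] sum_two_squares_iff[of k] by simp
  have "has_solution 0 2 0 k \<longleftrightarrow> k = 0 \<or>
      (k < 0 \<and> (\<forall>r :: int. prime r \<and> (\<exists>p :: int. r = 4 * p - 1) \<and> r dvd \<bar>k\<bar>
                   \<longrightarrow> even (multiplicity r \<bar>k\<bar>)))"
    unfolding has_solution_neg has_solution_2_iff sum_two_squares_iff by (cases "k < 0") simp_all
  then show "b = 2 \<and> a = 0 \<and> c = 0 \<longrightarrow>
      (has_solution a b c k \<longleftrightarrow> k = 0 \<or>
        (k < 0 \<and> (\<forall>r :: int. prime r \<and> (\<exists>p :: int. r = 4 * p - 1) \<and> r dvd \<bar>k\<bar>
                     \<longrightarrow> even (multiplicity r \<bar>k\<bar>))))"
    by blast
  show "a = 1 \<and> b = 1 \<and> c = 0 \<longrightarrow>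
      (\<not> (\<exists>p :: int. k = 4 * p + 2) \<longrightarrow> has_solution a b c k) \<and>
      ((\<exists>p :: int. k = 4 * p + 2) \<longrightarrow> \<not> has_solution a b c k)"
    using has_solution_1_1_iff[of k] difference_two_squares_iff[of k] by blast
  show "a = 1 \<and> b = 0 \<and> c = 0 \<longrightarrow> (has_solution a b c k \<longleftrightarrow> (\<exists>m :: int. k = m\<^sup>2))"
    using has_solution_1_iff[of k] by blast
  show "b = 1 \<and> a = 0 \<and> c = 0 \<longrightarrow> (has_solution a b c k \<longleftrightarrow> (\<exists>m :: int. - k = m\<^sup>2))"
    using has_solution_1_iff[of "- k"] has_solution_neg[of 1 k] by blast
  show "a = 0 \<and> b = 0 \<and> c \<ge> 1 \<longrightarrow> (even k \<longrightarrow> has_solution a b c k)"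
    using has_solution_hyperbolic[of c a b k] by blast
qed

end
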